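(* Let $p\in[1,+\infty)$, let $a\in[0,a_{\max}]$ and let $b>0$ be such that $ab\le 1$. Then there exists $\mathcal{D}^\star\in\mathfrak{D}_p^{a,b}$ such that $$\Lambda(\mathcal{D}^\star)=\sup_{\mathcal{D}\in\mathfrak{D}_p^{a,b}}\Lambda(\mathcal{D}).$$ In addition, for any nonempty open set $\Omega\subset\mathbb{T}^d$, such an optimal diffusion matrix $\mathcal{D}^\star$ is not identically zero on $\Omega$ (i.e. it is not equal to $0$ almost everywhere on $\Omega$).
   Context: Notation. $\mathbb{T}^d=(\mathbb{R}/\mathbb{Z})^d$ is the $d$-dimensional torus and $V\in C^\infty(\mathbb{T}^d)$ is a fixed real-valued function. Set $Z=\int_{\mathbb{T}^d}e^{-V(q)}\,dq$ and $\mu(q)=Z^{-1}e^{-V(q)}$; the probability measure with density $\mu$ is also denoted by $\mu$. $\mathcal{S}_d^+$ is the set of real symmetric positive semidefinite $d\times d$ matrices, with the Loewner order. $|\cdot|_{\mathrm F}$ is a fixed matrix norm which is monotone for the Loewner order: $|M_1|_{\mathrm F}\le|M_2|_{\mathrm F}$ whenever $0\le M_1\le M_2$ (for example the Frobenius or the spectral norm). Set $a_{\max}=1/|\mathrm{Id}_d|_{\mathrm F}$. For $a,b\ge 0$, let $\mathcal{M}_{a,b}=\{M\in\mathcal{S}_d^+ : a|\xi|^2\le \xi^\top M\xi\le \tfrac1b|\xi|^2 \text{ for all }\xi\in\mathbb{R}^d\}$, with the convention $1/b=+\infty$ if $b=0$. For measurable $\mathcal{D}:\mathbb{T}^d\to\mathcal{S}_d^+$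 and $1\le p<\infty$, $\|\mathcal{D}\|_{L^p_V}=\left(\int_{\mathbb{T}^d}|\mathcal{D}(q)|_{\mathrm F}^p\,e^{-pV(q)}\,dq\right)^{1/p}$, and $\|\mathcal{D}\|_{L^\infty_V}=\operatorname{ess\,sup}_{q}|\mathcal{D}(q)|_{\mathrm F}e^{-V(q)}$. Then $\mathfrak{D}_p^{a,b}$ is the set of measurable $\mathcal{D}:\mathbb{T}^d\to\mathcal{S}_d^+$ (identified up to a.e. equality) such that $\mathcal{D}(q)e^{-V(q)}\in\mathcal{M}_{a,b}$ for a.e. $q$, $\|\mathcal{D}\|_{L^\infty_V}<\infty$ and $\|\mathcal{D}\|_{L^p_V}\le 1$. $H^1(\mu)$ is the space of functions in $L^2(\mu)$ whose distributional first partial derivatives belong to $L^2(\mu)$, and $H^{1,0}(\mu)=\{u\in H^1(\mu):\int_{\mathbb{T}^d}u\,\mu\,dq=0\}$. For bounded measurable $\mathcal{D}$, $$\Lambda(\mathcal{D})=\inf_{u\in H^{1,0}(\mu)\setminus\{0\}}\frac{\int_{\mathbb{T}^d}\nabla u(q)^\top\mathcal{D}(q)\nabla u(q)\,\mu(q)\,dq}{\int_{\mathbb{T}^d}u(q)^2\mu(q)\,dq}.$$ *)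

theory Defs
  imports "HOL-Probability.Essential_Supremum"
begin

text \<open>
  A function (or, via its characteristic predicate, a subset) of the torus
  $(\mathbb{R}/\mathbb{Z})^d$ with $d = CARD('n)$ is represented by its $\mathbb{Z}^d$-periodic
  lift to \<^typ>\<open>real^'n\<close>. Open subsets of the torus correspond to open periodic sets, and
  integration over the torus is Lebesgue integration over a fundamental cell.
\<close>

definition Z_periodic :: "(real^'n \<Rightarrow> 'b) \<Rightarrow> bool" where
  "Z_periodic f \<longleftrightarrow> (\<forall>q i. f (q + axis i 1) = f q)"

definition unit_cell :: "(real^'n) set" where
  "unit_cell = {q. \<forall>i. 0 \<le> q $ i \<and> q $ i < 1}"

abbreviation torus :: "(real^'n) measure" where
  "torus \<equiv> lebesgue_on unit_cell"

definition partial_deriv :: "'n \<Rightarrow> (real^'n \<Rightarrow> real) \<Rightarrow> real^'n \<Rightarrow> real" where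
  "partial_deriv i f q = deriv (\<lambda>t. f (q + t *\<^sub>R axis i 1)) 0"

text \<open>
  Membership in $C^\infty$: differentiability of all iterated partial derivatives. It forces
  them to be continuous, so this is the usual notion.
\<close>

definition smooth :: "(real^'n \<Rightarrow> real) \<Rightarrow> bool" where
  "smooth f \<longleftrightarrow> (\<forall>is. foldr partial_deriv is f differentiable_on UNIV)"

definition smooth_torus :: "(real^'n \<Rightarrow> real) set" where
  "smooth_torus = {f. smooth f \<and> Z_periodic f}"

definition psd :: "real^'n^'n \<Rightarrow> bool" where
  "psd M \<longleftrightarrow> transpose M = M \<and> (\<forall>\<xi>. 0 \<le> \<xi> \<bullet> (M *v \<xi>))"

definition loewner_le :: "real^'n^'n \<Rightarrow> real^'n^'n \<Rightarrow> bool" where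
  "loewner_le M1 M2 \<longleftrightarrow> psd (M2 - M1)"

definition matrix_norm :: "(real^'n^'n \<Rightarrow> real) \<Rightarrow> bool" where
  "matrix_norm N \<longleftrightarrow>
     (\<forall>M. 0 \<le> N M) \<and> (\<forall>M. N M = 0 \<longleftrightarrow> M = 0) \<and>
     (\<forall>c M. N (c *\<^sub>R M) = \<bar>c\<bar> * N M) \<and> (\<forall>M1 M2. N (M1 + M2) \<le> N M1 + N M2)"

definition loewner_monotone :: "(real^'n^'n \<Rightarrow> real) \<Rightarrow> bool" where
  "loewner_monotone N \<longleftrightarrow> (\<forall>M1 M2. psd M1 \<and> loewner_le M1 M2 \<longrightarrow> N M1 \<le> N M2)"

definition a_max :: "(real^'n^'n \<Rightarrow> real) \<Rightarrow> real" where
  "a_max N = 1 / N (mat 1)"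

definition partition_const :: "(real^'n \<Rightarrow> real) \<Rightarrow> real" where
  "partition_const V = (\<integral>q. exp (- V q) \<partial>torus)"

definition gibbs :: "(real^'n \<Rightarrow> real) \<Rightarrow> real^'n \<Rightarrow> real" where
  "gibbs V q = exp (- V q) / partition_const V"

text \<open>The upper bound is dropped for $b = 0$, following the convention $1/0 = +\infty$.\<close>

definition bounded_matrices :: "real \<Rightarrow> real \<Rightarrow> (real^'n^'n) set" where
  "bounded_matrices a b =
     {M. psd M \<and> (\<forall>\<xi>. a * (norm \<xi>)\<^sup>2 \<le> \<xi> \<bullet> (M *v \<xi>) \<and>
                     (b \<noteq> 0 \<longrightarrow> \<xi> \<bullet> (M *v \<xi>) \<le> 1 / b * (norm \<xi>)\<^sup>2))}"

definition Lp_norm ::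
  "(real^'n^'n \<Rightarrow> real) \<Rightarrow> (real^'n \<Rightarrow> real) \<Rightarrow> real \<Rightarrow> (real^'n \<Rightarrow> real^'n^'n) \<Rightarrow> real" where
  "Lp_norm N V p D = (\<integral>q. N (D q) powr p * exp (- p * V q) \<partial>torus) powr (1 / p)"

definition Linf_norm ::
  "(real^'n^'n \<Rightarrow> real) \<Rightarrow> (real^'n \<Rightarrow> real) \<Rightarrow> (real^'n \<Rightarrow> real^'n^'n) \<Rightarrow> ereal" where
  "Linf_norm N V D = esssup torus (\<lambda>q. ereal (N (D q) * exp (- V q)))"

text \<open>
  Finiteness of the essential supremum makes the integrand in \<^const>\<open>Lp_norm\<close> integrable,
  so the bound on \<^const>\<open>Lp_norm\<close> below never refers to the default value of a divergent integral.
\<close>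

definition diffusions ::
  "(real^'n^'n \<Rightarrow> real) \<Rightarrow> (real^'n \<Rightarrow> real) \<Rightarrow> real \<Rightarrow> real \<Rightarrow> real \<Rightarrow> (real^'n \<Rightarrow> real^'n^'n) set"
where
  "diffusions N V p a b =
     {D. Z_periodic D \<and> D \<in> borel_measurable torus \<and> (\<forall>q. psd (D q)) \<and>
         (AE q in torus. exp (- V q) *\<^sub>R D q \<in> bounded_matrices a b) \<and>
         Linf_norm N V D < \<infinity> \<and> Lp_norm N V p D \<le> 1}"

definition L2_gibbs :: "(real^'n \<Rightarrow> real) \<Rightarrow> (real^'n \<Rightarrow> real) set" where
  "L2_gibbs V = {u. Z_periodic u \<and> u \<in> borel_measurable torus \<and>
                    integrable torus (\<lambda>q. (u q)\<^sup>2 * gibbs V q)}"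

text \<open>
  \<open>G\<close> is the distributional gradient of \<open>u\<close> on the torus (there is no boundary term, since the
  test functions are periodic), with components in $L^2(\mu)$. It is unique up to null sets.
\<close>

definition has_weak_gradient ::
  "(real^'n \<Rightarrow> real) \<Rightarrow> (real^'n \<Rightarrow> real) \<Rightarrow> (real^'n \<Rightarrow> real^'n) \<Rightarrow> bool" where
  "has_weak_gradient V u G \<longleftrightarrow>
     (\<forall>i. (\<lambda>q. G q $ i) \<in> L2_gibbs V) \<and>
     (\<forall>\<phi>\<in>smooth_torus. \<forall>i.
        (\<integral>q. u q * partial_deriv i \<phi> q \<partial>torus) = - (\<integral>q. G q $ i * \<phi> q \<partial>torus))"

definition H1 :: "(real^'n \<Rightarrow> real) \<Rightarrow> (real^'n \<Rightarrow> real) set" where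
  "H1 V = {u \<in> L2_gibbs V. \<exists>G. has_weak_gradient V u G}"

definition H1_zero_mean :: "(real^'n \<Rightarrow> real) \<Rightarrow> (real^'n \<Rightarrow> real) set" where
  "H1_zero_mean V = {u \<in> H1 V. (\<integral>q. u q * gibbs V q \<partial>torus) = 0}"

text \<open>
  The infimum ranges over nonzero \<open>u\<close> together with its gradient \<open>G\<close>; the quotient does not depend
  on the chosen representatives. It is taken in \<^typ>\<open>ereal\<close>, a complete lattice.
\<close>

definition spectral_gap :: "(real^'n \<Rightarrow> real) \<Rightarrow> (real^'n \<Rightarrow> real^'n^'n) \<Rightarrow> ereal" where
  "spectral_gap V D =
     (INF (u, G) \<in> {(u, G). u \<in> H1_zero_mean V \<and> \<not> (AE q in torus. u q = 0) \<and>
                            has_weak_gradient V u G}.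
        ereal ((\<integral>q. (G q \<bullet> (D q *v G q)) * gibbs V q \<partial>torus) /
               (\<integral>q. (u q)\<^sup>2 * gibbs V q \<partial>torus)))"

definition is_optimal ::
  "(real^'n^'n \<Rightarrow> real) \<Rightarrow> (real^'n \<Rightarrow> real) \<Rightarrow> real \<Rightarrow> real \<Rightarrow> real \<Rightarrow> (real^'n \<Rightarrow> real^'n^'n) \<Rightarrow> bool"
where
  "is_optimal N V p a b D \<longleftrightarrow>
     D \<in> diffusions N V p a b \<and>
     spectral_gap V D = (SUP D'\<in>diffusions N V p a b. spectral_gap V D')"

end

theory Submission
  imports Defs "HOL-Probability.Probability_Measure"
begin

text \<open>
  For fixed \<open>u\<close> the Rayleigh quotient is linear in \<open>D\<close>, so the spectral gap is concave and its
  superlevel sets are convex. A maximiser is found without weak compactness: in a decreasing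
  sequence of nonempty, convex, uniformly bounded sets of matrix fields, elements of nearly minimal
  $L^2$ norm form a Cauchy sequence by the parallelogram law. Almost everywhere convergence along
  a subsequence preserves the constraints and, by dominated convergence, every Rayleigh quotient.

  If an optimal \<open>D\<close> vanished on an open set, a function whose gradient is supported there would
  make its spectral gap nonpositive. But the field $c\, e^{V} \mathrm{Id}$ is admissible
  for some $c > 0$ and has a positive gap, by the Poincare inequality on the torus. The latter
  follows from Bessel's inequality for the gradient and the density of trigonometric polynomials
  in $L^2$.
\<close>

section \<open>Integration over the torus\<close>

text \<open>The maximisation works with the weighted field \<open>weighted V D\<close>, since the
  pointwise bound \<open>1 / b\<close> concerns this field. That bound yields the uniform norm bound
  behind the minimal-norm argument, and it dominates all energies of a fixed gradient
  \<open>G\<close> by a multiple of the square of \<open>norm (G q)\<close>. The supremum is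
  approached through an increasing sequence \<open>c\<close> of values taken by the gap; the sets in
  question are the fields with gap at least \<open>c n\<close>. The limit is not shown to lie in
  these sets directly: it inherits every bound \<open>c k\<close> through convergence of each
  Rayleigh quotient.

  For positivity of an isotropic gap, two means compete. Test functions have zero mean for the Gibbs
  measure, whereas the Fourier argument removes the Lebesgue mean. The Gibbs mean minimises the
  weighted variance, so the exchange costs nothing. The factor \<open>exp (V q)\<close> in the
  comparison field cancels the Gibbs weight and leaves the flat Dirichlet integral. For the
  degenerate field a test function of class C^1 is enough, because integration by parts on the torus
  uses only translation invariance.\<close>

lemma One_cart: "(One :: real^'n) = (\<chi> i. 1)"
proof -
  have "(One :: real^'n) $ i = 1" for i
    using inner_sum_left_Basis[of "axis i 1 :: real^'n" "\<lambda>_. 1"] cart_eq_inner_axis[of One i]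
    by (simp add: axis_in_Basis_iff)
  then show ?thesis by (simp add: vec_eq_iff)
qed

lemma unit_cell_bounds:
  shows "box 0 One \<subseteq> (unit_cell :: (real^'n) set)" "(unit_cell :: (real^'n) set) \<subseteq> cbox 0 One"
  by (auto simp: unit_cell_def mem_box_cart One_cart less_imp_le)

lemma borel_halfspaces [measurable]:
  "{q::real^'n. c \<le> q $ i} \<in> sets borel" "{q::real^'n. q $ i < c} \<in> sets borel"
  by (auto intro!: borel_closed borel_open closed_halfspace_component_ge_cart open_halfspace_component_lt_cart)

lemma borel_unit_cell [measurable]: "(unit_cell :: (real^'n) set) \<in> sets borel"
proof -
  have "(unit_cell :: (real^'n) set) = (\<Inter>i. {q. 0 \<le> q $ i} \<inter> {q. q $ i < 1})"
    by (auto simp: unit_cell_def)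
  also have "\<dots> \<in> sets borel" by (intro sets.finite_INT sets.Int borel_halfspaces) auto
  finally show ?thesis .
qed

lemma lebesgue_unit_cell [simp]: "(unit_cell :: (real^'n) set) \<in> sets lebesgue"
  by (simp add: borel_unit_cell)

lemma emeasure_unit_cell: "emeasure lebesgue (unit_cell :: (real^'n) set) = 1"
proof -
  have "emeasure lborel (cbox 0 (One::real^'n)) = 1" "emeasure lborel (box 0 (One::real^'n)) = 1"
    by (auto simp: emeasure_lborel_cbox_eq emeasure_lborel_box_eq)
  moreover have "emeasure lborel (unit_cell :: (real^'n) set) \<le> emeasure lborel (cbox 0 (One::real^'n))"
    "emeasure lborel (box 0 (One::real^'n)) \<le> emeasure lborel (unit_cell :: (real^'n) set)"
    by (intro emeasure_mono unit_cell_bounds; simp)+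
  ultimately show ?thesis by simp
qed

lemma space_torus [simp]: "space (torus :: (real^'n) measure) = unit_cell"
  by (simp add: space_restrict_space)

interpretation torus: prob_space "torus :: (real^'n) measure"
  by standard (simp add: emeasure_restrict_space emeasure_unit_cell)

lemma borel_measurable_torus:
  "f \<in> borel_measurable borel \<Longrightarrow> f \<in> borel_measurable torus"
  by (simp add: measurable_completion measurable_restrict_space1)

lemma borel_measurable_continuous_torus:
  "continuous_on UNIV f \<Longrightarrow> f \<in> borel_measurable torus"
  by (intro borel_measurable_torus borel_measurable_continuous_onI)

section \<open>Periodic functions and reduction to the unit cell\<close>

lemma Z_periodic_add_int:
  assumes "Z_periodic f" shows "f (q + of_int m *\<^sub>R axis i 1) = f q"
proof -
  have *: "f (q + of_nat k *\<^sub>R axis i 1) = f q" for q k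
  proof (induction k)
    case (Suc k)
    have "f (q + of_nat (Suc k) *\<^sub>R axis i 1) = f ((q + of_nat k *\<^sub>R axis i 1) + axis i 1)"
      by (simp add: algebra_simps)
    then show ?case using assms Suc by (simp add: Z_periodic_def)
  qed simp
  show ?thesis
  proof (cases m)
    case (nonneg n) then show ?thesis using * by simp
  next
    case (neg n)
    then have "q + of_int m *\<^sub>R axis i 1 + of_nat (Suc n) *\<^sub>R axis i 1 = q"
      by (simp flip: scaleR_left_distrib add: add.assoc)
    then show ?thesis using *[of "q + of_int m *\<^sub>R axis i 1" "Suc n"] by metis
  qed
qed

lemma Z_periodic_add_ints:
  fixes f :: "real^'n \<Rightarrow> 'b"
  assumes "Z_periodic f" shows "f (q + (\<chi> i. of_int (m i))) = f q"
proof -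
  have *: "f (q + (\<Sum>i\<in>A. of_int (m i) *\<^sub>R axis i 1)) = f q" if "finite A" for A
    using that
  proof induction
    case (insert i A)
    have "q + (\<Sum>i\<in>insert i A. of_int (m i) *\<^sub>R axis i 1) =
        (q + (\<Sum>i\<in>A. of_int (m i) *\<^sub>R axis i 1)) + of_int (m i) *\<^sub>R axis i 1"
      using insert by (simp add: algebra_simps)
    then show ?case
      using insert Z_periodic_add_int[OF assms, of "q + (\<Sum>i\<in>A. of_int (m i) *\<^sub>R axis i 1)" "m i" i]
      by (simp add: ac_simps)
  qed simp
  have "(\<chi> i. of_int (m i)) = (\<Sum>i\<in>UNIV. of_int (m i) *\<^sub>R axis i (1::real))"
  proof -
    have "(of_int (m i) *\<^sub>R axis i (1::real)) $ j = (if i = j then of_int (m i) else 0)" for i j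
      by (simp add: axis_def)
    then show ?thesis by (auto simp: vec_eq_iff)
  qed
  then show ?thesis using *[of UNIV] by simp
qed

text \<open>Subtracting the coordinatewise floors lands in the cell. Bounds obtained on the compact
  closed box thereby hold on the whole space.\<close>

lemma Z_periodic_floor:
  fixes f :: "real^'n \<Rightarrow> 'b"
  assumes "Z_periodic f" obtains q' where "q' \<in> unit_cell" "f q = f q'"
proof -
  let ?q = "q + (\<chi> i. of_int (- \<lfloor>q $ i\<rfloor>))"
  have "?q \<in> unit_cell" by (simp add: unit_cell_def) linarith
  moreover have "f q = f ?q" by (metis Z_periodic_add_ints[OF assms])
  ultimately show ?thesis using that by blast
qed

lemma continuous_periodic_bounded:
  fixes f :: "real^'n \<Rightarrow> real"
  assumes "Z_periodic f" "continuous_on UNIV f"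
  obtains B where "0 < B" "\<And>q. \<bar>f q\<bar> \<le> B"
proof -
  have "compact (f ` cbox 0 One)"
    using assms(2) continuous_on_subset by (intro compact_continuous_image) auto
  then obtain B where B: "0 < B" "\<forall>x\<in>f ` cbox 0 One. norm x \<le> B"
    using bounded_pos compact_imp_bounded by blast
  have "\<bar>f q\<bar> \<le> B" for q
    using Z_periodic_floor[OF assms(1), of q] B unit_cell_bounds(2) by (metis image_eqI real_norm_def subsetD)
  then show ?thesis using that B by blast
qed

lemma integrable_torus_continuous:
  fixes f :: "real^'n \<Rightarrow> real"
  assumes "Z_periodic f" "continuous_on UNIV f"
  shows "integrable torus f"
proof -
  obtain B where "\<And>q. \<bar>f q\<bar> \<le> B" using continuous_periodic_bounded[OF assms] by blast
  then show ?thesis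
    by (intro torus.integrable_const_bound[where B=B] borel_measurable_continuous_torus assms) auto
qed

section \<open>Translation invariance of the integral over the torus\<close>

lemma integral_torus_borel:
  fixes f :: "real^'n \<Rightarrow> real"
  assumes "f \<in> borel_measurable borel"
  shows "integral\<^sup>L torus f = (\<integral>q. indicator unit_cell q * f q \<partial>lborel)"
  using assms by (subst integral_restrict_space) (auto simp: integral_completion)

lemma lborel_integral_translate:
  fixes f :: "'a::euclidean_space \<Rightarrow> real"
  assumes "f \<in> borel_measurable borel"
  shows "(\<integral>q. f (q + c) \<partial>lborel) = integral\<^sup>L lborel f"
proof -
  have "integral\<^sup>L lborel f = integral\<^sup>L (distr lborel borel ((+) c)) f"
    by (simp only: lborel_distr_plus)
  also have "\<dots> = (\<integral>q. f (c + q) \<partial>lborel)"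
    using assms by (subst integral_distr) auto
  finally show ?thesis by (simp add: add.commute)
qed

text \<open>In direction \<open>i\<close> the shifted cell occupies \<open>[t, 1 + t)\<close>.
  Cutting it at 1 and moving the overhang back by one period rebuilds the original cell.\<close>

lemma torus_integral_translate:
  fixes f :: "real^'n \<Rightarrow> real"
  assumes "Z_periodic f" "continuous_on UNIV f" and t: "0 \<le> t" "t \<le> 1"
  shows "(\<integral>q. f (q + t *\<^sub>R axis i 1) \<partial>torus) = integral\<^sup>L torus f"
proof -
  define e where "e = axis i (1::real)"
  have e: "e $ j = (if j = i then 1 else 0)" for j by (simp add: e_def axis_def)
  have fper: "f (q + e) = f q" for q using assms(1) by (auto simp: Z_periodic_def e_def)
  have fm[measurable]: "f \<in> borel_measurable borel" by (rule borel_measurable_continuous_onI[OF assms(2)])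
  \<comment> \<open>\<open>C\<close> is the cell with coordinate \<open>i\<close> left free;
    \<open>S u v\<close> is the slab of \<open>C\<close> in which this coordinate runs through
    \<open>[u, v)\<close>.\<close>
  define C where "C = {q::real^'n. \<forall>j. j \<noteq> i \<longrightarrow> 0 \<le> q $ j \<and> q $ j < 1}"
  have C: "C \<in> sets borel"
  proof -
    have "C = (\<Inter>j\<in>UNIV-{i}. {q. 0 \<le> q $ j} \<inter> {q. q $ j < 1}) \<inter> space borel"
      by (auto simp: C_def)
    then show ?thesis by (cases "UNIV - {i} = {}") (auto intro!: sets.finite_INT borel_halfspaces)
  qed
  define S where "S u v = C \<inter> {q. u \<le> q $ i \<and> q $ i < v}" for u v
  have S[measurable]: "S u v \<in> sets borel" for u v
  proof -
    have "C \<inter> ({q. u \<le> q $ i} \<inter> {q. q $ i < v}) \<in> sets borel" using C borel_halfspaces by blast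
    then show ?thesis by (simp add: S_def Collect_conj_eq)
  qed
  have cell: "unit_cell = S 0 1" by (auto simp: unit_cell_def S_def C_def)
  obtain B where B: "\<And>q. \<bar>f q\<bar> \<le> B" using continuous_periodic_bounded[OF assms(1,2)] by blast
  \<comment> \<open>Bounded slabs have finite measure, so the bounded function \<open>f\<close> is
    integrable on each of them.\<close>
  have bdd: "S u v \<subseteq> cbox (\<chi> j. min 0 u) (\<chi> j. max 1 v)" for u v
  proof
    fix q assume q: "q \<in> S u v"
    have "min 0 u \<le> q $ j \<and> q $ j \<le> max 1 v" for j
      using q by (cases "j = i") (auto simp: S_def C_def min_def max_def less_imp_le)
    then show "q \<in> cbox (\<chi> j. min 0 u) (\<chi> j. max 1 v)" by (simp add: mem_box_cart)
  qed
  have fin: "emeasure lborel (S u v) < \<infinity>" for u v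
    by (meson bdd bounded_cbox bounded_subset emeasure_bounded_finite)
  have int: "integrable lborel (\<lambda>q. indicator (S u v) q * f q)" for u v
  proof (rule integrableI_bounded_set[where A="S u v" and B=B])
    show "AE x\<in>S u v in lborel. norm (indicator (S u v) x * f x) \<le> B"
      using B by (auto simp: abs_mult)
  qed (use fin in auto)
  have shift: "(\<integral>q. indicator (S u v) q * f (q + s *\<^sub>R e) \<partial>lborel) =
      (\<integral>q. indicator (S (u + s) (v + s)) q * f q \<partial>lborel)" for u v s
  proof -
    have "indicator (S (u + s) (v + s)) (q + s *\<^sub>R e) = (indicator (S u v) q :: real)" for q
      by (auto simp: S_def C_def indicator_def e)
    then show ?thesis
      using lborel_integral_translate[of "\<lambda>q. indicator (S (u + s) (v + s)) q * f q" "s *\<^sub>R e"] by simp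
  qed
  have split: "(\<integral>q. indicator (S u w) q * f q \<partial>lborel) =
      (\<integral>q. indicator (S u v) q * f q \<partial>lborel) + (\<integral>q. indicator (S v w) q * f q \<partial>lborel)"
    if "u \<le> v" "v \<le> w" for u v w
  proof -
    have "indicator (S u w) q * f q = indicator (S u v) q * f q + indicator (S v w) q * f q" for q
      using that by (auto simp: S_def indicator_def)
    then show ?thesis using int by simp
  qed
  have "(\<integral>q. f (q + t *\<^sub>R axis i 1) \<partial>torus) = (\<integral>q. indicator (S 0 1) q * f (q + t *\<^sub>R e) \<partial>lborel)"
    by (subst integral_torus_borel) (auto simp: cell e_def)
  also have "\<dots> = (\<integral>q. indicator (S t (1 + t)) q * f q \<partial>lborel)" using shift[of 0 1 t] by simp
  also have "\<dots> = (\<integral>q. indicator (S t 1) q * f q \<partial>lborel) + (\<integral>q. indicator (S 1 (1+t)) q * f q \<partial>lborel)"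
    using split[of t 1 "1 + t"] t by simp
  \<comment> \<open>By periodicity the overhang past 1 contributes as much as the initial slab that
    the shift has uncovered.\<close>
  also have "(\<integral>q. indicator (S 1 (1+t)) q * f q \<partial>lborel) = (\<integral>q. indicator (S 0 t) q * f q \<partial>lborel)"
    using shift[of 0 t 1] by (simp add: fper add.commute)
  also have "(\<integral>q. indicator (S t 1) q * f q \<partial>lborel) + (\<integral>q. indicator (S 0 t) q * f q \<partial>lborel) =
      (\<integral>q. indicator (S 0 1) q * f q \<partial>lborel)"
    using split[of 0 t 1] t by simp
  also have "\<dots> = integral\<^sup>L torus f" by (subst integral_torus_borel) (auto simp: cell)
  finally show ?thesis .
qed

section \<open>Fourier coefficients and trigonometric polynomials\<close>

definition phase :: "int^'n \<Rightarrow> real^'n \<Rightarrow> real" where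
  "phase k q = (\<Sum>i\<in>UNIV. of_int (k $ i) * q $ i)"

definition torus_char :: "int^'n \<Rightarrow> real^'n \<Rightarrow> complex" where
  "torus_char k q = cis (2 * pi * phase k q)"

lemma phase_add_axis: "phase k (q + t *\<^sub>R axis i 1) = phase k q + t * of_int (k $ i)"
proof -
  have "of_int (k $ j) * (q + t *\<^sub>R axis i 1) $ j =
      of_int (k $ j) * q $ j + (if j = i then t * of_int (k $ i) else 0)" for j
    by (simp add: axis_def algebra_simps)
  then show ?thesis by (simp add: phase_def sum.distrib)
qed

lemma continuous_on_phase [continuous_intros]: "continuous_on S (phase k)"
  unfolding phase_def by (intro continuous_intros)

lemma norm_torus_char [simp]: "norm (torus_char k q) = 1"
  by (simp add: torus_char_def)

lemma torus_char_mult: "torus_char k q * torus_char l q = torus_char (k + l) q"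
  by (simp add: torus_char_def cis_mult phase_def sum.distrib algebra_simps)

lemma cnj_torus_char: "cnj (torus_char k q) = torus_char (- k) q"
  by (simp add: torus_char_def cis_cnj phase_def sum_negf)

lemma torus_char_0 [simp]: "torus_char 0 q = 1"
  by (simp add: torus_char_def phase_def)

lemma torus_char_add_axis:
  "torus_char k (q + t *\<^sub>R axis i 1) = cis (2 * pi * t * of_int (k $ i)) * torus_char k q"
  by (simp add: torus_char_def phase_add_axis cis_mult algebra_simps)

lemma continuous_on_torus_char [continuous_intros]: "continuous_on S (torus_char k)"
  unfolding torus_char_def by (intro continuous_intros)

lemma Z_periodic_torus_char: "Z_periodic (torus_char k)"
  using torus_char_add_axis[of k _ 1] cis_multiple_2pi
  by (auto simp: Z_periodic_def)

lemma borel_measurable_torus_char [measurable]: "torus_char k \<in> borel_measurable torus"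
  by (intro borel_measurable_continuous_torus continuous_intros)

lemma integrable_torus_char [simp]: "integrable torus (torus_char k)"
  by (intro torus.integrable_const_bound[where B=1]) auto

text \<open>If \<open>k\<close> has a nonzero component, a shift by half a period in that direction
  changes the sign of the character. Translation invariance then makes the integral equal to its own
  negative.\<close>

lemma integral_torus_char: "integral\<^sup>L torus (torus_char (k :: int^'n)) = of_bool (k = 0)"
proof (cases "k = 0")
  case True
  then have "torus_char k = (\<lambda>_. 1)" by auto
  then show ?thesis using True torus.prob_space[where 'n='n] by simp
next
  case False
  then obtain i where i: "k $ i \<noteq> 0" by (auto simp: vec_eq_iff)
  \<comment> \<open>Half a period of the character in direction \<open>i\<close>; as
    \<open>k $ i\<close> is a nonzero integer, \<open>t\<close> is at most 1/2.\<close>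
  define t where "t = 1 / (2 * \<bar>real_of_int (k $ i)\<bar>)"
  have "1 \<le> \<bar>real_of_int (k $ i)\<bar>" using i by linarith
  then have t: "0 \<le> t" "t \<le> 1" by (auto simp: t_def divide_simps)
  have "2 * pi * t * of_int (k $ i) = pi \<or> 2 * pi * t * of_int (k $ i) = - pi"
    using i by (auto simp: t_def field_simps abs_if)
  then have "cos (2 * pi * t * of_int (k $ i)) = - 1 \<and> sin (2 * pi * t * of_int (k $ i)) = 0"
    by (elim disjE) (simp_all only: cos_pi sin_pi cos_minus sin_minus, simp_all)
  then have "cis (2 * pi * t * of_int (k $ i)) = - 1" by (simp add: complex_eq_iff del: mult_cancel_left)
  then have *: "torus_char k (q + t *\<^sub>R axis i 1) = - torus_char k q" for q
    by (auto simp: torus_char_add_axis)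
  have "(\<integral>q. f (torus_char k (q + t *\<^sub>R axis i 1)) \<partial>torus) = (\<integral>q. f (torus_char k q) \<partial>torus)"
    if "f = Re \<or> f = Im" for f
  proof (rule torus_integral_translate[OF _ _ t])
    show "Z_periodic (\<lambda>q. f (torus_char k q))"
      using Z_periodic_torus_char[of k] by (simp add: Z_periodic_def)
    show "continuous_on UNIV (\<lambda>q. f (torus_char k q))" using that by (auto intro!: continuous_intros)
  qed
  from this[of Re] this[of Im] have "(\<integral>q. Re (torus_char k q) \<partial>torus) = 0" "(\<integral>q. Im (torus_char k q) \<partial>torus) = 0"
    by (auto simp: *)
  then show ?thesis using False by (simp add: complex_eq_iff)
qed

lemma torus_char_orthonormal:
  "(\<integral>q. torus_char k q * cnj (torus_char l q) \<partial>torus) = of_bool (k = l)"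
  using integral_torus_char[of "k - l"] by (simp add: cnj_torus_char torus_char_mult)

definition fourier_coeff :: "(real^'n \<Rightarrow> real) \<Rightarrow> int^'n \<Rightarrow> complex" where
  "fourier_coeff u k = (\<integral>q. of_real (u q) * cnj (torus_char k q) \<partial>torus)"

lemma torus_square_integrable_imp_integrable:
  fixes u :: "real^'n \<Rightarrow> real"
  assumes "u \<in> borel_measurable torus" "integrable torus (\<lambda>q. (u q)\<^sup>2)"
  shows "integrable torus u"
proof (rule Bochner_Integration.integrable_bound[where f="\<lambda>q. 1 + (u q)\<^sup>2"])
  have "\<bar>x\<bar> \<le> 1 + x\<^sup>2" for x :: real
    using zero_le_power2[of "\<bar>x\<bar> - 1"] by (simp add: power2_diff)
  then show "AE q in torus. norm (u q) \<le> norm (1 + (u q)\<^sup>2)" by (auto intro: order_trans)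
qed (use assms in auto)

lemma integrable_mult_torus_char:
  assumes "integrable torus u"
  shows "integrable torus (\<lambda>q. of_real (u q) * torus_char k q)"
  by (rule Bochner_Integration.integrable_bound[OF assms]) (use assms in \<open>auto simp: norm_mult\<close>)

text \<open>Expanding the square and using orthonormality completes the square in each coefficient.
  Taking \<open>c\<close> to be the Fourier coefficients gives Bessel's inequality; taking the
  coefficients of a good approximant bounds the norm of \<open>u\<close> from above.\<close>

lemma bessel_identity:
  fixes u :: "real^'n \<Rightarrow> real"
  assumes u: "u \<in> borel_measurable torus" and u2: "integrable torus (\<lambda>q. (u q)\<^sup>2)" and F: "finite F"
  shows "(\<integral>q. (norm (of_real (u q) - (\<Sum>k\<in>F. c k * torus_char k q)))\<^sup>2 \<partial>torus) =
    (\<integral>q. (u q)\<^sup>2 \<partial>torus) - (\<Sum>k\<in>F. (norm (fourier_coeff u k))\<^sup>2) + (\<Sum>k\<in>F. (norm (fourier_coeff u k - c k))\<^sup>2)"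
    (is "?L = ?R")
proof -
  have int: "integrable torus u" by (rule torus_square_integrable_imp_integrable[OF u u2])
  note i1 = integrable_mult_torus_char[OF int]
  have i2: "integrable torus (\<lambda>q. of_real (u q) * cnj (torus_char k q))" for k
    using i1[of "- k"] by (simp add: cnj_torus_char)
  have i3: "integrable torus (\<lambda>q. torus_char k q * cnj (torus_char l q))" for k l
    by (simp add: cnj_torus_char torus_char_mult)
  \<comment> \<open>As \<open>u\<close> is real, integrating against the character itself gives the
    conjugate coefficient.\<close>
  have cn: "(\<integral>q. of_real (u q) * torus_char k q \<partial>torus) = cnj (fourier_coeff u k)" for k
  proof -
    have "(\<lambda>q. of_real (u q) * torus_char k q) = (\<lambda>q. cnj (of_real (u q) * cnj (torus_char k q)))"
      by simp
    then show ?thesis by (simp only: fourier_coeff_def Bochner_Integration.integral_cnj)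
  qed
  have h1: "has_bochner_integral torus (\<lambda>q. complex_of_real ((u q)\<^sup>2)) (of_real (\<integral>q. (u q)\<^sup>2 \<partial>torus))"
    using u2 by (simp only: has_bochner_integral_iff integral_complex_of_real complex_of_real_integrable_eq)
  have h2: "has_bochner_integral torus (\<lambda>q. of_real (u q) * cnj (torus_char k q)) (fourier_coeff u k)" for k
    using i2 by (simp only: has_bochner_integral_iff fourier_coeff_def)
  have h3: "has_bochner_integral torus (\<lambda>q. of_real (u q) * torus_char k q) (cnj (fourier_coeff u k))" for k
    using i1 by (simp only: has_bochner_integral_iff cn)
  have h4: "has_bochner_integral torus (\<lambda>q. torus_char k q * cnj (torus_char l q)) (of_bool (k = l))" for k l
    using i3 by (simp add: has_bochner_integral_iff torus_char_orthonormal)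
  have point: "complex_of_real ((norm (of_real (u q) - (\<Sum>k\<in>F. c k * torus_char k q)))\<^sup>2) =
      of_real ((u q)\<^sup>2) - (\<Sum>k\<in>F. cnj (c k) * (of_real (u q) * cnj (torus_char k q)))
       - (\<Sum>k\<in>F. c k * (of_real (u q) * torus_char k q))
       + (\<Sum>k\<in>F. \<Sum>l\<in>F. c k * cnj (c l) * (torus_char k q * cnj (torus_char l q)))" for q
  proof -
    have "complex_of_real ((norm (of_real (u q) - (\<Sum>k\<in>F. c k * torus_char k q)))\<^sup>2) =
      (of_real (u q) - (\<Sum>k\<in>F. c k * torus_char k q)) * (of_real (u q) - (\<Sum>k\<in>F. cnj (c k) * cnj (torus_char k q)))"
      by (subst complex_norm_square) simp
    also have "\<dots> = of_real ((u q)\<^sup>2) - of_real (u q) * (\<Sum>k\<in>F. cnj (c k) * cnj (torus_char k q))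
       - of_real (u q) * (\<Sum>k\<in>F. c k * torus_char k q)
       + (\<Sum>k\<in>F. c k * torus_char k q) * (\<Sum>k\<in>F. cnj (c k) * cnj (torus_char k q))"
      by (simp add: algebra_simps power2_eq_square)
    also have "of_real (u q) * (\<Sum>k\<in>F. cnj (c k) * cnj (torus_char k q)) =
        (\<Sum>k\<in>F. cnj (c k) * (of_real (u q) * cnj (torus_char k q)))"
      by (simp add: sum_distrib_left ac_simps)
    also have "of_real (u q) * (\<Sum>k\<in>F. c k * torus_char k q) =
        (\<Sum>k\<in>F. c k * (of_real (u q) * torus_char k q))"
      by (simp add: sum_distrib_left ac_simps)
    also have "(\<Sum>k\<in>F. c k * torus_char k q) * (\<Sum>k\<in>F. cnj (c k) * cnj (torus_char k q)) =
        (\<Sum>k\<in>F. \<Sum>l\<in>F. c k * cnj (c l) * (torus_char k q * cnj (torus_char l q)))"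
      by (simp add: sum_product ac_simps)
    finally show ?thesis .
  qed
  have "complex_of_real ?L = (\<integral>q. complex_of_real ((norm (of_real (u q) - (\<Sum>k\<in>F. c k * torus_char k q)))\<^sup>2) \<partial>torus)"
    by (rule integral_complex_of_real[symmetric])
  also have "\<dots> = of_real (\<integral>q. (u q)\<^sup>2 \<partial>torus) - (\<Sum>k\<in>F. cnj (c k) * fourier_coeff u k)
     - (\<Sum>k\<in>F. c k * cnj (fourier_coeff u k)) + (\<Sum>k\<in>F. \<Sum>l\<in>F. c k * cnj (c l) * of_bool (k = l))"
    unfolding point
    by (intro has_bochner_integral_integral_eq has_bochner_integral_add has_bochner_integral_diff
        has_bochner_integral_sum has_bochner_integral_mult_right h1 h2 h3 h4)
  also have "(\<Sum>k\<in>F. \<Sum>l\<in>F. c k * cnj (c l) * of_bool (k = l)) = (\<Sum>k\<in>F. c k * cnj (c k))"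
    using F by (intro sum.cong) (auto simp: of_bool_def if_distrib[of "\<lambda>x. _ * x"] cong: if_cong)
  also have "of_real (\<integral>q. (u q)\<^sup>2 \<partial>torus) - (\<Sum>k\<in>F. cnj (c k) * fourier_coeff u k)
     - (\<Sum>k\<in>F. c k * cnj (fourier_coeff u k)) + (\<Sum>k\<in>F. c k * cnj (c k)) = complex_of_real ?R"
    by (simp only: of_real_add of_real_diff of_real_sum complex_norm_square)
      (simp add: algebra_simps sum.distrib sum_subtractf)
  finally show ?thesis by (simp only: of_real_eq_iff)
qed

lemma bessel_inequality:
  fixes u :: "real^'n \<Rightarrow> real"
  assumes "u \<in> borel_measurable torus" "integrable torus (\<lambda>q. (u q)\<^sup>2)" "finite F"
  shows "(\<Sum>k\<in>F. (norm (fourier_coeff u k))\<^sup>2) \<le> (\<integral>q. (u q)\<^sup>2 \<partial>torus)"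
proof -
  have "0 \<le> (\<integral>q. (norm (of_real (u q) - (\<Sum>k\<in>F. fourier_coeff u k * torus_char k q)))\<^sup>2 \<partial>torus)"
    by simp
  then show ?thesis using bessel_identity[OF assms, of "fourier_coeff u"] by simp
qed

section \<open>The algebra of trigonometric polynomials\<close>

inductive trig_poly :: "(real^'n \<Rightarrow> complex) \<Rightarrow> bool" where
  monom: "trig_poly (\<lambda>q. c * torus_char k q)"
| add: "trig_poly f \<Longrightarrow> trig_poly g \<Longrightarrow> trig_poly (\<lambda>q. f q + g q)"

text \<open>The inductive presentation makes closure under products a plain induction; this normal
  form with one coefficient per frequency is what \<open>bessel_identity\<close> takes as
  input.\<close>

lemma trig_poly_sum:
  assumes "trig_poly f"
  obtains F c where "finite F" "f = (\<lambda>q. \<Sum>k\<in>F. c k * torus_char k q)"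
proof -
  have "\<exists>F c. finite F \<and> f = (\<lambda>q. \<Sum>k\<in>F. c k * torus_char k q)"
    using assms
  proof induction
    case (monom c k)
    show ?case by (intro exI[of _ "{k}"] exI[of _ "\<lambda>_. c"]) auto
  next
    case (add f g)
    then obtain F c G d where F: "finite F" "f = (\<lambda>q. \<Sum>k\<in>F. c k * torus_char k q)"
      and G: "finite G" "g = (\<lambda>q. \<Sum>k\<in>G. d k * torus_char k q)" by blast
    \<comment> \<open>Both coefficient families are extended by 0, so that frequencies common to
      \<open>F\<close> and \<open>G\<close> have their coefficients added.\<close>
    define e where "e k = (if k \<in> F then c k else 0) + (if k \<in> G then d k else 0)" for k
    have "(\<Sum>k\<in>F \<union> G. e k * torus_char k q) = f q + g q" for q
    proof -
      have "(\<Sum>k\<in>F \<union> G. e k * torus_char k q) = (\<Sum>k\<in>F \<union> G. (if k \<in> F then c k * torus_char k q else 0))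
         + (\<Sum>k\<in>F \<union> G. (if k \<in> G then d k * torus_char k q else 0))"
        by (simp add: e_def distrib_right sum.distrib[symmetric] if_distrib[of "\<lambda>x. x * _"] cong: if_cong)
      also have "\<dots> = f q + g q"
        using F G by (simp add: sum.If_cases Int_absorb1)
      finally show ?thesis .
    qed
    then show ?case using F G by (intro exI[of _ "F \<union> G"] exI[of _ e]) auto
  qed
  then show ?thesis using that by blast
qed

lemma trig_poly_mult: "trig_poly f \<Longrightarrow> trig_poly g \<Longrightarrow> trig_poly (\<lambda>q. f q * g q)"
proof (induction rule: trig_poly.induct)
  case (monom c k)
  from monom show ?case
  proof (induction rule: trig_poly.induct)
    case (monom d l)
    have "(\<lambda>q. c * torus_char k q * (d * torus_char l q)) = (\<lambda>q. (c * d) * torus_char (k + l) q)"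
      by (simp add: torus_char_mult[symmetric] fun_eq_iff)
    then show ?case by (simp add: trig_poly.monom)
  next
    case (add f g)
    then show ?case using trig_poly.add by (simp add: distrib_left)
  qed
next
  case (add f1 f2)
  then show ?case using trig_poly.add by (simp add: distrib_right)
qed

lemma trig_poly_const: "trig_poly (\<lambda>q. c)"
  using trig_poly.monom[of c 0] by simp

lemma trig_poly_continuous: "trig_poly f \<Longrightarrow> continuous_on S f"
  by (induction rule: trig_poly.induct) (intro continuous_intros; assumption)+

lemma trig_poly_periodic: "trig_poly f \<Longrightarrow> Z_periodic f"
proof (induction rule: trig_poly.induct)
  case (monom c k)
  then show ?case using Z_periodic_torus_char[of k] by (simp add: Z_periodic_def)
qed (simp add: Z_periodic_def)

text \<open>Stone-Weierstrass is applied to an algebra of real functions, while the coefficients of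
  the expansion remain complex; hence the condition is placed on the embedding into the complex
  numbers.\<close>

definition real_trig_poly :: "(real^'n \<Rightarrow> real) \<Rightarrow> bool" where
  "real_trig_poly f \<longleftrightarrow> trig_poly (\<lambda>q. of_real (f q))"

lemma real_trig_poly_continuous:
  assumes "real_trig_poly f" shows "continuous_on S f"
proof -
  have "continuous_on S (\<lambda>q. Re (of_real (f q)))"
    using trig_poly_continuous[of _ S] assms unfolding real_trig_poly_def by (intro continuous_on_Re) blast
  then show ?thesis by simp
qed

lemma real_trig_poly_periodic:
  assumes "real_trig_poly f" shows "Z_periodic f"
  using trig_poly_periodic assms unfolding real_trig_poly_def by (fastforce simp: Z_periodic_def)

lemma real_trig_poly_add: "real_trig_poly f \<Longrightarrow> real_trig_poly g \<Longrightarrow> real_trig_poly (\<lambda>q. f q + g q)"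
  using trig_poly.add by (fastforce simp: real_trig_poly_def)

lemma real_trig_poly_mult: "real_trig_poly f \<Longrightarrow> real_trig_poly g \<Longrightarrow> real_trig_poly (\<lambda>q. f q * g q)"
  using trig_poly_mult by (fastforce simp: real_trig_poly_def)

lemma real_trig_poly_const: "real_trig_poly (\<lambda>q. c)"
  by (simp add: real_trig_poly_def trig_poly_const)

lemma real_trig_poly_char:
  "real_trig_poly (\<lambda>q. cos (2 * pi * phase k q))" "real_trig_poly (\<lambda>q. sin (2 * pi * phase k q))"
proof -
  have "(\<lambda>q. complex_of_real (cos (2 * pi * phase k q))) = (\<lambda>q. 1/2 * torus_char k q + 1/2 * torus_char (-k) q)"
    by (simp add: fun_eq_iff complex_eq_iff torus_char_def phase_def sum_negf)
  moreover have "(\<lambda>q. complex_of_real (sin (2 * pi * phase k q))) = (\<lambda>q. (-\<i>/2) * torus_char k q + \<i>/2 * torus_char (-k) q)"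
    by (simp add: fun_eq_iff complex_eq_iff torus_char_def phase_def sum_negf)
  ultimately show "real_trig_poly (\<lambda>q. cos (2 * pi * phase k q))" "real_trig_poly (\<lambda>q. sin (2 * pi * phase k q))"
    unfolding real_trig_poly_def by (simp_all only: trig_poly.intros)
qed

text \<open>Serves to replace a continuous function of a trigonometric polynomial, the truncation,
  by a polynomial in it.\<close>

lemma real_trig_poly_compose:
  assumes "real_polynomial_function g" "real_trig_poly f"
  shows "real_trig_poly (\<lambda>q. g (f q))"
  using assms
proof (induction rule: real_polynomial_function.induct)
  case (linear g)
  then obtain c where "g = (\<lambda>x. x * c)" using real_bounded_linear by blast
  then show ?case using real_trig_poly_mult[OF linear(2) real_trig_poly_const] by simp
qed (auto intro: real_trig_poly_const real_trig_poly_add real_trig_poly_mult)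

section \<open>Density of trigonometric polynomials\<close>

text \<open>Truncation to \<open>[- M, M]\<close> for nonnegative \<open>M\<close>. It is
  1-Lipschitz and fixes values bounded by \<open>M\<close>, so it bounds approximants without
  spoiling the approximation.\<close>

definition clamp_to :: "real \<Rightarrow> real \<Rightarrow> real" where
  "clamp_to M x = max (- M) (min M x)"

lemma clamp_to_abs_le: "0 \<le> M \<Longrightarrow> \<bar>clamp_to M x\<bar> \<le> M"
  by (auto simp: clamp_to_def)

lemma clamp_to_eq: "\<bar>x\<bar> \<le> M \<Longrightarrow> clamp_to M x = x"
  by (auto simp: clamp_to_def)

lemma abs_clamp_to_le: "0 \<le> M \<Longrightarrow> \<bar>clamp_to M x\<bar> \<le> \<bar>x\<bar>"
  by (auto simp: clamp_to_def)

lemma clamp_to_dist_le: "\<bar>clamp_to M x - clamp_to M y\<bar> \<le> \<bar>x - y\<bar>"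
  by (auto simp: clamp_to_def)

lemma continuous_on_clamp_to [continuous_intros]:
  "continuous_on S f \<Longrightarrow> continuous_on S (\<lambda>q. clamp_to M (f q))"
  unfolding clamp_to_def by (intro continuous_intros)

lemma borel_measurable_clamp_to [measurable]: "clamp_to M \<in> borel_measurable borel"
  by (intro borel_measurable_continuous_onI continuous_intros)

definition L2_approximable :: "(real^'n \<Rightarrow> real) \<Rightarrow> bool" where
  "L2_approximable u \<longleftrightarrow> (\<forall>\<epsilon>>0. \<exists>f. real_trig_poly f \<and> (\<integral>q. (u q - f q)\<^sup>2 \<partial>torus) < \<epsilon>)"

lemma integrable_power2_diff:
  fixes u v :: "'a \<Rightarrow> real"
  assumes [measurable]: "u \<in> borel_measurable M" "v \<in> borel_measurable M"
    and "integrable M (\<lambda>q. (u q)\<^sup>2)" "integrable M (\<lambda>q. (v q)\<^sup>2)"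
  shows "integrable M (\<lambda>q. (u q - v q)\<^sup>2)"
proof (rule Bochner_Integration.integrable_bound[where f="\<lambda>q. 2 * (u q)\<^sup>2 + 2 * (v q)\<^sup>2"])
  have "(x - y)\<^sup>2 \<le> 2 * x\<^sup>2 + 2 * y\<^sup>2" for x y :: real
    using zero_le_power2[of "x + y"] by (simp add: power2_diff power2_sum)
  then show "AE q in M. norm ((u q - v q)\<^sup>2) \<le> norm (2 * (u q)\<^sup>2 + 2 * (v q)\<^sup>2)" by auto
qed (use assms in auto)

lemma real_trig_poly_measurable [measurable_dest]: "real_trig_poly f \<Longrightarrow> f \<in> borel_measurable torus"
  by (intro borel_measurable_continuous_torus real_trig_poly_continuous)

lemma real_trig_poly_integrable2: "real_trig_poly f \<Longrightarrow> integrable torus (\<lambda>q. (f q)\<^sup>2)"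
  using real_trig_poly_mult[of f f]
  by (intro integrable_torus_continuous real_trig_poly_continuous real_trig_poly_periodic)
    (simp_all add: power2_eq_square)

text \<open>The approximable functions are closed under mean-square limits. The triangle inequality
  appears as (x - z)^2 \<le> 2 (x - y)^2 + 2 (y - z)^2, whence the tolerance
  \<open>\<epsilon> / 4\<close> for both errors.\<close>

lemma L2_approximable_limit:
  fixes u :: "real^'n \<Rightarrow> real"
  assumes u: "u \<in> borel_measurable torus" "integrable torus (\<lambda>q. (u q)\<^sup>2)"
    and v: "\<And>n. v n \<in> borel_measurable torus" "\<And>n. integrable torus (\<lambda>q. (v n q)\<^sup>2)" "\<And>n. L2_approximable (v n)"
    and lim: "(\<lambda>n::nat. \<integral>q. (u q - v n q)\<^sup>2 \<partial>torus) \<longlonglongrightarrow> 0"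
  shows "L2_approximable u"
  unfolding L2_approximable_def
proof (intro allI impI)
  fix \<epsilon> :: real assume "0 < \<epsilon>"
  then obtain n where n: "(\<integral>q. (u q - v n q)\<^sup>2 \<partial>torus) < \<epsilon> / 4"
    using order_tendstoD(2)[OF lim, of "\<epsilon> / 4"] by (auto simp: eventually_sequentially)
  obtain f where f: "real_trig_poly f" "(\<integral>q. (v n q - f q)\<^sup>2 \<partial>torus) < \<epsilon> / 4"
    using v(3)[of n] \<open>0 < \<epsilon>\<close> unfolding L2_approximable_def by (meson divide_pos_pos zero_less_numeral)
  note f' = real_trig_poly_measurable[OF f(1)] real_trig_poly_integrable2[OF f(1)]
  note i1 = integrable_power2_diff[OF u(1) v(1) u(2) v(2), of n]
    and i2 = integrable_power2_diff[OF v(1) f'(1) v(2) f'(2), of n]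
    and i3 = integrable_power2_diff[OF u(1) f'(1) u(2) f'(2)]
  have *: "(x - z)\<^sup>2 \<le> 2 * (x - y)\<^sup>2 + 2 * (y - z)\<^sup>2" for x y z :: real
    using zero_le_power2[of "(x - y) - (y - z)"] by (simp add: power2_eq_square algebra_simps)
  have "(\<integral>q. (u q - f q)\<^sup>2 \<partial>torus) \<le> (\<integral>q. 2 * (u q - v n q)\<^sup>2 + 2 * (v n q - f q)\<^sup>2 \<partial>torus)"
    using i1 i2 i3 * by (intro integral_mono) auto
  also have "\<dots> = 2 * (\<integral>q. (u q - v n q)\<^sup>2 \<partial>torus) + 2 * (\<integral>q. (v n q - f q)\<^sup>2 \<partial>torus)"
    using i1 i2 by simp
  also have "\<dots> < \<epsilon>" using n f(2) by simp
  finally show "\<exists>f. real_trig_poly f \<and> (\<integral>q. (u q - f q)\<^sup>2 \<partial>torus) < \<epsilon>" using f(1) by blast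
qed

text \<open>Truncation leaves the algebra. As \<open>f\<close> takes values in some
  \<open>[- B, B]\<close>, a polynomial uniformly close to \<open>clamp_to M\<close> there can be
  composed with \<open>f\<close> instead.\<close>

lemma real_trig_poly_clamp_approx:
  fixes f :: "real^'n \<Rightarrow> real"
  assumes "real_trig_poly f" "0 < e"
  obtains g where "real_trig_poly g" "\<And>q. \<bar>clamp_to M (f q) - g q\<bar> < e"
proof -
  obtain B where B: "\<And>q. \<bar>f q\<bar> \<le> B"
    using continuous_periodic_bounded[OF real_trig_poly_periodic real_trig_poly_continuous] assms(1) by metis
  obtain h where h: "real_polynomial_function h" "\<And>x. x \<in> {-B..B} \<Longrightarrow> \<bar>clamp_to M x - h x\<bar> < e"
  proof (rule Stone_Weierstrass_real_polynomial_function[of "{-B..B}" "clamp_to M" e])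
    show "continuous_on {-B..B} (clamp_to M)"
      using continuous_on_clamp_to[OF continuous_on_id, of "{-B..B}" M] by simp
  qed (use assms(2) in auto)
  have "f q \<in> {-B..B}" for q using B[of q] by auto
  then show ?thesis using that[OF real_trig_poly_compose[OF h(1) assms(1)]] h(2) by blast
qed

text \<open>Cosine and sine of \<open>2 * pi * x $ i\<close> determine \<open>x $ i\<close> modulo
  1, and coordinates of points in the half-open cell differ by less than 1.\<close>

lemma real_trig_poly_separates:
  fixes x y :: "real^'n"
  assumes "x \<in> unit_cell" "y \<in> unit_cell" "x \<noteq> y"
  shows "\<exists>f. real_trig_poly f \<and> f x \<noteq> f y"
proof -
  obtain i where i: "x $ i \<noteq> y $ i" using assms(3) by (auto simp: vec_eq_iff)
  have ph: "phase (axis i 1) q = q $ i" for q :: "real^'n"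
  proof -
    have "of_int ((axis i 1 :: int^'n) $ j) * q $ j = (if j = i then q $ i else 0)" for j
      by (simp add: axis_def)
    then show ?thesis by (simp add: phase_def)
  qed
  show ?thesis
  proof (rule ccontr)
    assume "\<not> ?thesis"
    then have "cos (2 * pi * x $ i) = cos (2 * pi * y $ i)" "sin (2 * pi * x $ i) = sin (2 * pi * y $ i)"
      using real_trig_poly_char[of "axis i 1 :: int^'n"] unfolding ph by blast+
    then obtain m :: int where "2 * pi * x $ i = 2 * pi * y $ i + 2 * pi * of_int m"
      using sin_cos_eq_iff by (metis mult.commute mult.left_commute)
    then have "2 * pi * (x $ i) = 2 * pi * (y $ i + of_int m)" by (simp add: algebra_simps)
    then have m: "x $ i = y $ i + of_int m" by simp
    have "\<bar>x $ i - y $ i\<bar> < 1" using assms(1,2) by (auto simp: unit_cell_def abs_less_iff) (smt (verit))+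
    then have "m = 0" using m by linarith
    then show False using m i by simp
  qed
qed

text \<open>The function need not be periodic. The closed unit box is compact, but characters
  identify its opposite faces; the half-open cell is separated, but not compact. So
  Stone-Weierstrass is used on a smaller compact box of nearly full measure, and truncation controls
  the approximant on the remainder.\<close>

lemma L2_approximable_continuous:
  fixes u :: "real^'n \<Rightarrow> real"
  assumes u: "continuous_on UNIV u" and M: "0 < M" "\<And>q. \<bar>u q\<bar> \<le> M"
  shows "L2_approximable u"
  unfolding L2_approximable_def
proof (intro allI impI)
  fix \<epsilon> :: real assume \<epsilon>: "0 < \<epsilon>"
  define S where "S m = cbox (0::real^'n) (\<chi> i. 1 - 1 / real (Suc m))" for m
  have S_sub: "S m \<subseteq> unit_cell" for m
  proof
    fix q assume "q \<in> S m"
    moreover have "1 - 1 / real (Suc m) < 1" by simp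
    ultimately show "q \<in> unit_cell"
      unfolding S_def unit_cell_def mem_box_cart by (auto intro: order.strict_trans1)
  qed
  have S_meas: "S m \<in> sets torus" for m
    using S_sub by (simp add: sets_restrict_space_iff S_def)
  have "(\<lambda>m. measure torus (S m)) \<longlonglongrightarrow> measure torus (\<Union>m. S m)"
  proof (rule torus.finite_Lim_measure_incseq)
    show "incseq S"
      unfolding incseq_def S_def
    proof (intro allI impI subsetI)
      fix m n :: nat and q :: "real^'n"
      assume "m \<le> n" "q \<in> cbox 0 (\<chi> i. 1 - 1 / real (Suc m))"
      moreover have "1 - 1 / real (Suc m) \<le> 1 - 1 / real (Suc n)" using \<open>m \<le> n\<close> by (simp add: frac_le)
      ultimately show "q \<in> cbox 0 (\<chi> i. 1 - 1 / real (Suc n))"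
        unfolding mem_box_cart by (auto intro: order_trans)
    qed
  qed (use S_meas in auto)
  moreover have "(\<Union>m. S m) = unit_cell"
  proof (intro antisym UN_least S_sub subsetI)
    fix q :: "real^'n" assume q: "q \<in> unit_cell"
    have "eventually (\<lambda>m. \<forall>i\<in>UNIV. q $ i \<le> 1 - 1 / real (Suc m)) sequentially"
    proof (intro eventually_ball_finite ballI)
      fix i
      have "(\<lambda>m. 1 - 1 / real (Suc m)) \<longlonglongrightarrow> 1 - 0"
        by (intro tendsto_diff tendsto_const LIMSEQ_Suc[OF lim_1_over_n])
      then have "eventually (\<lambda>m. q $ i < 1 - 1 / real (Suc m)) sequentially"
        using q by (intro order_tendstoD) (auto simp: unit_cell_def)
      then show "eventually (\<lambda>m. q $ i \<le> 1 - 1 / real (Suc m)) sequentially"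
        by eventually_elim simp
    qed simp
    then obtain m where "\<forall>i. q $ i \<le> 1 - 1 / real (Suc m)" by (auto simp: eventually_sequentially)
    then have "q \<in> S m" using q by (simp add: S_def mem_box_cart unit_cell_def)
    then show "q \<in> (\<Union>m. S m)" by blast
  qed
  ultimately have "(\<lambda>m. measure torus (S m)) \<longlonglongrightarrow> 1"
    using torus.prob_space[where 'n='n] by simp
  \<comment> \<open>Off \<open>S m\<close> the squared error is at most 8 M^2 plus a term already
    counted in 4 e^2, so this threshold lets the remainder contribute less than
    \<open>\<epsilon> / 2\<close>. With \<open>e\<close> below, the uniform part 4 e^2 is
    \<open>\<epsilon> / 4\<close>.\<close>
  then have "eventually (\<lambda>m. 1 - \<epsilon> / (16 * M\<^sup>2) < measure torus (S m)) sequentially"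
    using \<epsilon> M(1) by (intro order_tendstoD) auto
  then obtain m where m: "1 - \<epsilon> / (16 * M\<^sup>2) < measure torus (S m)" by (auto simp: eventually_sequentially)
  define e where "e = sqrt \<epsilon> / 4"
  have e: "0 < e" "e\<^sup>2 = \<epsilon> / 16" using \<epsilon> by (auto simp: e_def power_divide)
  interpret R: function_ring_on "Collect real_trig_poly" "S m"
  proof
    show "compact (S m)" by (simp add: S_def)
    show "\<exists>f\<in>Collect real_trig_poly. f x \<noteq> f y" if "x \<in> S m" "y \<in> S m" "x \<noteq> y" for x y
      using that S_sub real_trig_poly_separates by blast
  qed (auto intro: real_trig_poly_continuous real_trig_poly_add real_trig_poly_mult real_trig_poly_const)
  obtain f where f: "real_trig_poly f" "\<And>q. q \<in> S m \<Longrightarrow> \<bar>u q - f q\<bar> < e"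
    using R.Stone_Weierstrass_basic[OF continuous_on_subset[OF u] e(1)] by auto
  obtain g where g: "real_trig_poly g" "\<And>q. \<bar>clamp_to M (f q) - g q\<bar> < e"
    using real_trig_poly_clamp_approx[OF f(1) e(1)] by blast
  have sq: "(u q - g q)\<^sup>2 \<le> 4 * e\<^sup>2 + 8 * M\<^sup>2 * indicator (unit_cell - S m) q" if "q \<in> unit_cell" for q
  proof -
    have *: "(u q - g q)\<^sup>2 \<le> 2 * (u q - clamp_to M (f q))\<^sup>2 + 2 * (clamp_to M (f q) - g q)\<^sup>2"
      using zero_le_power2[of "(u q - clamp_to M (f q)) - (clamp_to M (f q) - g q)"]
      by (simp add: power2_eq_square algebra_simps)
    have 1: "(clamp_to M (f q) - g q)\<^sup>2 \<le> e\<^sup>2"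
      using g(2)[of q] by (intro abs_le_square_iff[THEN iffD1]) auto
    show ?thesis
    proof (cases "q \<in> S m")
      case True
      have "\<bar>u q - clamp_to M (f q)\<bar> \<le> \<bar>u q - f q\<bar>"
        using clamp_to_dist_le[of M "u q" "f q"] clamp_to_eq[OF M(2)[of q]] by simp
      then have "(u q - clamp_to M (f q))\<^sup>2 \<le> e\<^sup>2"
        using f(2)[OF True] by (intro abs_le_square_iff[THEN iffD1]) auto
      then show ?thesis using * 1 True by simp
    next
      case False
      \<comment> \<open>Outside \<open>S m\<close> nothing is known about \<open>f\<close>, but both
        terms are bounded by \<open>M\<close>.\<close>
      have "\<bar>u q - clamp_to M (f q)\<bar> \<le> 2 * M"
        using M(2)[of q] clamp_to_abs_le[of M "f q"] M(1) by linarith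
      then have "(u q - clamp_to M (f q))\<^sup>2 \<le> (2 * M)\<^sup>2"
        using M(1) by (intro abs_le_square_iff[THEN iffD1]) auto
      then show ?thesis using * 1 False that by (simp add: power_mult_distrib) (smt (verit) zero_le_power2)
    qed
  qed
  have Sc: "unit_cell - S m \<in> sets torus" using sets.compl_sets[OF S_meas[of m]] by simp
  have "(\<integral>q. (u q - g q)\<^sup>2 \<partial>torus) \<le> (\<integral>q. 4 * e\<^sup>2 + 8 * M\<^sup>2 * indicator (unit_cell - S m) q \<partial>torus)"
  proof (rule integral_mono)
    have "integrable torus (\<lambda>q. (u q)\<^sup>2)"
    proof (rule torus.integrable_const_bound[where B="M\<^sup>2"])
      show "AE q in torus. norm ((u q)\<^sup>2) \<le> M\<^sup>2"
        using M by (auto simp: abs_le_square_iff[symmetric])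
    qed (intro borel_measurable_continuous_torus continuous_intros u)
    then show "integrable torus (\<lambda>q. (u q - g q)\<^sup>2)"
      by (intro integrable_power2_diff real_trig_poly_measurable[OF g(1)] real_trig_poly_integrable2[OF g(1)]
          borel_measurable_continuous_torus[OF u])
    show "integrable torus (\<lambda>q. 4 * e\<^sup>2 + 8 * M\<^sup>2 * indicator (unit_cell - S m) q)"
      using Sc
      by (intro Bochner_Integration.integrable_add integrable_mult_right integrable_real_indicator)
        (auto simp: torus.emeasure_eq_measure)
  qed (use sq in auto)
  also have "\<dots> = 4 * e\<^sup>2 + 8 * M\<^sup>2 * measure torus (unit_cell - S m)"
    using Sc torus.prob_space[where 'n='n] by (subst Bochner_Integration.integral_add) (auto simp: torus.emeasure_eq_measure Int_absorb2)
  also have "measure torus (unit_cell - S m) = 1 - measure torus (S m)"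
    using torus.prob_compl[OF S_meas] by simp
  also have "4 * e\<^sup>2 + 8 * M\<^sup>2 * (1 - measure torus (S m)) < 4 * e\<^sup>2 + 8 * M\<^sup>2 * (\<epsilon> / (16 * M\<^sup>2))"
    using m M(1) by (intro add_strict_left_mono mult_strict_left_mono) auto
  also have "\<dots> < \<epsilon>" using e(2) M(1) \<epsilon> by simp
  finally show "\<exists>f. real_trig_poly f \<and> (\<integral>q. (u q - f q)\<^sup>2 \<partial>torus) < \<epsilon>" using g(1) by blast
qed


text \<open>Lebesgue measurability gives continuous functions that converge to \<open>u\<close> on
  the cell off a negligible set. Truncating them at \<open>M\<close> keeps the limit and provides
  the constant dominating function.\<close>

lemma L2_approximable_bounded:
  fixes u :: "real^'n \<Rightarrow> real"
  assumes u: "u \<in> borel_measurable torus" and M: "0 < M" "\<And>q. \<bar>u q\<bar> \<le> M"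
  shows "L2_approximable u"
proof -
  have "(\<lambda>q. indicator unit_cell q *\<^sub>R u q) \<in> borel_measurable lebesgue"
    using u by (subst (asm) borel_measurable_restrict_space_iff) auto
  then have "(\<lambda>q. indicator unit_cell q *\<^sub>R u q) measurable_on unit_cell"
    by (intro lebesgue_measurable_imp_measurable_on lebesgue_unit_cell)
  then obtain N g where N: "negligible N" and g: "\<And>n. continuous_on UNIV (g n)"
    and lim: "\<And>q. q \<notin> N \<Longrightarrow> (\<lambda>n. g n q) \<longlonglongrightarrow> (if q \<in> unit_cell then indicator unit_cell q *\<^sub>R u q else 0)"
    unfolding measurable_on_def by blast
  define v where "v n q = clamp_to M (g n q)" for n q
  have cv: "continuous_on UNIV (v n)" for n unfolding v_def by (intro continuous_intros g)
  have vM: "\<bar>v n q\<bar> \<le> M" for n q using M(1) clamp_to_abs_le unfolding v_def by simp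
  have b2: "integrable torus (\<lambda>q. (w q)\<^sup>2)" if "w \<in> borel_measurable torus" "\<And>q. \<bar>w q\<bar> \<le> M" for w
  proof (rule torus.integrable_const_bound[where B="M\<^sup>2"])
    show "AE q in torus. norm ((w q)\<^sup>2) \<le> M\<^sup>2"
      using that(2) M by (auto simp: abs_le_square_iff[symmetric])
  qed (use that in measurable)
  have AE_lim: "AE q in torus. (\<lambda>n. v n q) \<longlonglongrightarrow> u q"
  proof -
    have "AE q in lebesgue. q \<notin> N"
      using N by (simp add: negligible_iff_null_sets AE_not_in)
    then have "AE q in torus. q \<notin> N" by (auto simp: AE_restrict_space_iff)
    moreover have "AE q in torus. q \<in> (unit_cell :: (real^'n) set)" by (metis AE_space space_torus)
    ultimately show ?thesis
    proof eventually_elim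
      case (elim q)
      then have "(\<lambda>n. g n q) \<longlonglongrightarrow> u q" using lim[of q] by simp
      then have "(\<lambda>n. v n q) \<longlonglongrightarrow> clamp_to M (u q)"
        unfolding v_def clamp_to_def by (intro tendsto_intros)
      then show ?case by (simp add: clamp_to_eq M)
    qed
  qed
  have vm: "v n \<in> borel_measurable torus" for n by (intro borel_measurable_continuous_torus cv)
  show ?thesis
  proof (rule L2_approximable_limit[where v=v])
    have "(\<lambda>n. \<integral>q. (u q - v n q)\<^sup>2 \<partial>torus) \<longlonglongrightarrow> (\<integral>q. 0 \<partial>(torus :: (real^'n) measure))"
    proof (rule integral_dominated_convergence[where w="\<lambda>_. (2 * M)\<^sup>2"])
      show "AE q in torus. (\<lambda>n. (u q - v n q)\<^sup>2) \<longlonglongrightarrow> 0"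
        using AE_lim
      proof eventually_elim
        case (elim q)
        then have "(\<lambda>n. (u q - v n q)\<^sup>2) \<longlonglongrightarrow> (u q - u q)\<^sup>2" by (intro tendsto_intros)
        then show ?case by simp
      qed
      show "AE q in torus. norm ((u q - v n q)\<^sup>2) \<le> (2 * M)\<^sup>2" for n
      proof (rule AE_I2)
        fix q
        have "\<bar>u q - v n q\<bar> \<le> \<bar>2 * M\<bar>" using M(2)[of q] vM[of n q] M(1) by linarith
        then show "norm ((u q - v n q)\<^sup>2) \<le> (2 * M)\<^sup>2" by (simp add: abs_le_square_iff)
      qed
    qed (use u vm in auto)
    then show "(\<lambda>n. \<integral>q. (u q - v n q)\<^sup>2 \<partial>torus) \<longlonglongrightarrow> 0" by simp
    show "L2_approximable (v n)" for n by (rule L2_approximable_continuous[OF cv M(1) vM])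
    show "integrable torus (\<lambda>q. (v n q)\<^sup>2)" for n by (rule b2[OF vm vM])
    show "integrable torus (\<lambda>q. (u q)\<^sup>2)" by (rule b2[OF u M(2)])
  qed (fact u vm)+
qed

text \<open>Truncations of \<open>u\<close> at growing heights equal \<open>u\<close> eventually at
  each point, and the squared error stays below 4 u^2; dominated convergence reduces the claim to
  bounded functions.\<close>

theorem L2_approximable:
  fixes u :: "real^'n \<Rightarrow> real"
  assumes u: "u \<in> borel_measurable torus" "integrable torus (\<lambda>q. (u q)\<^sup>2)"
  shows "L2_approximable u"
proof -
  define v where "v n q = clamp_to (real (Suc n)) (u q)" for n q
  have vm: "v n \<in> borel_measurable torus" for n unfolding v_def using u(1) by measurable
  have vle: "\<bar>v n q\<bar> \<le> \<bar>u q\<bar>" for n q unfolding v_def by (intro abs_clamp_to_le) simp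
  show ?thesis
  proof (rule L2_approximable_limit[where v=v])
    have "(\<lambda>n. \<integral>q. (u q - v n q)\<^sup>2 \<partial>torus) \<longlonglongrightarrow> (\<integral>q. 0 \<partial>(torus :: (real^'n) measure))"
    proof (rule integral_dominated_convergence[where w="\<lambda>q. 4 * (u q)\<^sup>2"])
      show "AE q in torus. (\<lambda>n. (u q - v n q)\<^sup>2) \<longlonglongrightarrow> 0"
      proof (rule AE_I2)
        fix q
        obtain m where "\<bar>u q\<bar> \<le> real m" using real_arch_simple by blast
        then have "eventually (\<lambda>n. (u q - v n q)\<^sup>2 = 0) sequentially"
          unfolding v_def eventually_sequentially by (intro exI[of _ m]) (auto simp: clamp_to_eq)
        then show "(\<lambda>n. (u q - v n q)\<^sup>2) \<longlonglongrightarrow> 0" by (rule tendsto_eventually)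
      qed
      show "AE q in torus. norm ((u q - v n q)\<^sup>2) \<le> 4 * (u q)\<^sup>2" for n
      proof (rule AE_I2)
        fix q
        have "\<bar>u q - v n q\<bar> \<le> \<bar>2 * u q\<bar>" using vle[of n q] by linarith
        then have "(u q - v n q)\<^sup>2 \<le> (2 * u q)\<^sup>2" by (simp only: abs_le_square_iff)
        then show "norm ((u q - v n q)\<^sup>2) \<le> 4 * (u q)\<^sup>2" by (simp add: power_mult_distrib)
      qed
    qed (use u vm in auto)
    then show "(\<lambda>n. \<integral>q. (u q - v n q)\<^sup>2 \<partial>torus) \<longlonglongrightarrow> 0" by simp
    show "integrable torus (\<lambda>q. (v n q)\<^sup>2)" for n
      by (rule Bochner_Integration.integrable_bound[OF u(2)])
        (use vm vle in \<open>auto simp: abs_le_square_iff[symmetric]\<close>)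
    show "L2_approximable (v n)" for n
      by (rule L2_approximable_bounded[OF vm, of "real (Suc n)"]) (auto simp: v_def intro!: clamp_to_abs_le)
  qed (use u vm in auto)
qed

corollary L2_le_fourier_coeffs:
  fixes u :: "real^'n \<Rightarrow> real"
  assumes u: "u \<in> borel_measurable torus" "integrable torus (\<lambda>q. (u q)\<^sup>2)"
    and C: "\<And>F. finite F \<Longrightarrow> (\<Sum>k\<in>F. (norm (fourier_coeff u k))\<^sup>2) \<le> C"
  shows "(\<integral>q. (u q)\<^sup>2 \<partial>torus) \<le> C"
proof (rule field_le_epsilon)
  fix \<epsilon> :: real assume "0 < \<epsilon>"
  then obtain f where f: "real_trig_poly f" "(\<integral>q. (u q - f q)\<^sup>2 \<partial>torus) < \<epsilon>"
    using L2_approximable[OF u] by (auto simp: L2_approximable_def)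
  obtain F c where F: "finite F" "(\<lambda>q. complex_of_real (f q)) = (\<lambda>q. \<Sum>k\<in>F. c k * torus_char k q)"
    using trig_poly_sum f(1) unfolding real_trig_poly_def by blast
  have "(norm (of_real (u q) - (\<Sum>k\<in>F. c k * torus_char k q)))\<^sup>2 = (u q - f q)\<^sup>2" for q
    by (simp add: fun_cong[OF F(2), symmetric] flip: of_real_diff)
  then have "(\<integral>q. (u q)\<^sup>2 \<partial>torus) - (\<Sum>k\<in>F. (norm (fourier_coeff u k))\<^sup>2) +
      (\<Sum>k\<in>F. (norm (fourier_coeff u k - c k))\<^sup>2) < \<epsilon>"
    using bessel_identity[OF u F(1), of c] f(2) by simp
  moreover have "0 \<le> (\<Sum>k\<in>F. (norm (fourier_coeff u k - c k))\<^sup>2)" by (intro sum_nonneg) simp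
  ultimately show "(\<integral>q. (u q)\<^sup>2 \<partial>torus) \<le> C + \<epsilon>" using C[OF F(1)] by linarith
qed

section \<open>Weak gradients and the Poincare inequality\<close>

lemma partial_deriv_eq:
  assumes "((\<lambda>t. f (q + t *\<^sub>R axis i 1)) has_real_derivative D) (at 0)"
  shows "partial_deriv i f q = D"
  using assms unfolding partial_deriv_def by (rule DERIV_imp_deriv)

text \<open>Differentiation rescales the amplitude and advances \<open>\<theta>\<close> by
  \<open>pi / 2\<close>. Keeping a free phase thus gives a family closed under partial derivatives,
  which contains the sines and makes smoothness an induction on the list of derivatives.\<close>

lemma has_real_derivative_cos_phase:
  "((\<lambda>t. c * cos (2 * pi * phase k (q + t *\<^sub>R axis i 1) + \<theta>)) has_real_derivative
     c * (2 * pi * of_int (k $ i)) * cos (2 * pi * phase k q + (\<theta> + pi / 2))) (at 0)"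
  unfolding phase_add_axis
  by (auto intro!: derivative_eq_intros simp: cos_add sin_add algebra_simps)

lemma partial_deriv_cos_phase:
  "partial_deriv i (\<lambda>q. c * cos (2 * pi * phase k q + \<theta>)) =
    (\<lambda>q. c * (2 * pi * of_int (k $ i)) * cos (2 * pi * phase k q + (\<theta> + pi / 2)))"
  using partial_deriv_eq[OF has_real_derivative_cos_phase] by blast

lemma differentiable_phase: "phase k differentiable at q"
proof -
  have "phase k = (\<lambda>q. (\<chi> i. of_int (k $ i)) \<bullet> q)" by (simp add: phase_def inner_vec_def fun_eq_iff)
  then show ?thesis by (simp add: bounded_linear_imp_differentiable bounded_linear_inner_right)
qed

lemma smooth_torus_cos_phase: "(\<lambda>q. c * cos (2 * pi * phase k q + \<theta>)) \<in> smooth_torus"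
proof -
  have "\<exists>c' \<theta>'. foldr partial_deriv is (\<lambda>q. c * cos (2 * pi * phase k q + \<theta>)) =
      (\<lambda>q. c' * cos (2 * pi * phase k q + \<theta>'))" for "is"
  proof (induction "is")
    case (Cons i "is")
    then show ?case using partial_deriv_cos_phase by fastforce
  qed auto
  moreover have "(\<lambda>q. c' * cos (2 * pi * phase k q + \<theta>')) differentiable_on UNIV" for c' \<theta>'
  proof -
    have "(\<lambda>q. c' * cos (2 * pi * phase k q + \<theta>')) = (\<lambda>x. c' * cos (2 * pi * x + \<theta>')) \<circ> phase k"
      by auto
    moreover have "(\<lambda>x. c' * cos (2 * pi * x + \<theta>')) differentiable at x" for x
      unfolding real_differentiable_def by (rule exI) (auto intro!: derivative_eq_intros)
    ultimately show ?thesis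
      by (metis differentiable_chain_at differentiable_phase differentiable_at_imp_differentiable_on)
  qed
  ultimately have "smooth (\<lambda>q. c * cos (2 * pi * phase k q + \<theta>))"
    unfolding smooth_def by metis
  moreover have "cos (2 * pi * (phase k q + of_int (k $ i)) + \<theta>) = cos (2 * pi * phase k q + \<theta>)" for q i
  proof -
    have eq: "2 * pi * (phase k q + of_int (k $ i)) + \<theta> = (2 * pi * phase k q + \<theta>) + 2 * pi * of_int (k $ i)"
      by (simp add: algebra_simps)
    have per: "cos (x + 2 * pi * of_int (k $ i)) = cos x" for x
      by (simp add: cos_add)
    show ?thesis unfolding eq per ..
  qed
  ultimately show ?thesis
    using phase_add_axis[of k _ 1] by (simp add: smooth_torus_def Z_periodic_def)
qed

lemma smooth_torus_continuous: "V \<in> smooth_torus \<Longrightarrow> continuous_on S V"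
  unfolding smooth_torus_def smooth_def
  by (metis (no_types, lifting) continuous_on_subset differentiable_imp_continuous_on foldr.simps(1) id_apply mem_Collect_eq subset_UNIV)

lemma smooth_torus_periodic: "V \<in> smooth_torus \<Longrightarrow> Z_periodic V"
  by (simp add: smooth_torus_def)

section \<open>The Gibbs density and its square-integrable functions\<close>

lemma partition_const_pos:
  fixes V :: "real^'n \<Rightarrow> real"
  assumes "V \<in> smooth_torus"
  shows "0 < partition_const V"
proof -
  have V: "Z_periodic V" "continuous_on UNIV V"
    using assms smooth_torus_continuous smooth_torus_periodic by auto
  obtain B where B: "\<And>q. \<bar>V q\<bar> \<le> B" using continuous_periodic_bounded[OF V] by blast
  have "0 < exp (- B)" by simp
  also have "exp (- B) = (\<integral>q. exp (- B) \<partial>(torus :: (real^'n) measure))"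
    using torus.prob_space[where 'n='n] by simp
  also have "\<dots> \<le> partition_const V"
    unfolding partition_const_def
  proof (rule integral_mono)
    show "integrable torus (\<lambda>q. exp (- V q))"
      by (intro integrable_torus_continuous continuous_intros V) (use V(1) in \<open>simp add: Z_periodic_def\<close>)
    show "exp (- B) \<le> exp (- V q)" for q using B[of q] by simp
  qed simp
  finally show ?thesis .
qed

lemma gibbs_bounds:
  fixes V :: "real^'n \<Rightarrow> real"
  assumes "V \<in> smooth_torus"
  obtains m M where "0 < m" "\<And>q. m \<le> gibbs V q" "\<And>q. gibbs V q \<le> M"
proof -
  have V: "Z_periodic V" "continuous_on UNIV V"
    using assms smooth_torus_continuous smooth_torus_periodic by auto
  obtain B where B: "\<And>q. \<bar>V q\<bar> \<le> B" using continuous_periodic_bounded[OF V] by blast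
  have Z: "0 < partition_const V" by (rule partition_const_pos[OF assms])
  show ?thesis
  proof (rule that[of "exp (- B) / partition_const V" "exp B / partition_const V"])
    show "exp (- B) / partition_const V \<le> gibbs V q" "gibbs V q \<le> exp B / partition_const V" for q
      using B[of q] Z by (auto simp: gibbs_def divide_le_cancel)
  qed (use Z in simp)
qed


lemma borel_measurable_gibbs:
  assumes "V \<in> smooth_torus" shows "gibbs V \<in> borel_measurable torus"
  unfolding gibbs_def
  by (intro borel_measurable_divide borel_measurable_const borel_measurable_continuous_torus
      continuous_intros smooth_torus_continuous assms)

lemma integral_gibbs:
  fixes V :: "real^'n \<Rightarrow> real"
  assumes "V \<in> smooth_torus"
  shows "integrable torus (gibbs V)" "integral\<^sup>L torus (gibbs V) = 1"
proof -
  have V: "Z_periodic (gibbs V)" "continuous_on UNIV (gibbs V)"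
    using smooth_torus_periodic[OF assms] unfolding gibbs_def
    using partition_const_pos[OF assms]
    by (auto simp: Z_periodic_def intro!: continuous_intros smooth_torus_continuous[OF assms])
  show "integrable torus (gibbs V)" by (rule integrable_torus_continuous[OF V])
  show "integral\<^sup>L torus (gibbs V) = 1"
    using partition_const_pos[OF assms] unfolding gibbs_def by (simp add: partition_const_def)
qed

text \<open>The density lies between two positive constants, so the weight does not affect square
  integrability and Fourier analysis can be done with Lebesgue measure.\<close>

lemma L2_gibbs_iff:
  fixes V :: "real^'n \<Rightarrow> real"
  assumes "V \<in> smooth_torus"
  shows "u \<in> L2_gibbs V \<longleftrightarrow>
    Z_periodic u \<and> u \<in> borel_measurable torus \<and> integrable torus (\<lambda>q. (u q)\<^sup>2)"
proof -
  obtain m M where m: "0 < m" "\<And>q. m \<le> gibbs V q" and M: "\<And>q. gibbs V q \<le> M"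
    using gibbs_bounds[OF assms] by blast
  note [measurable] = borel_measurable_gibbs[OF assms]
  have "integrable torus (\<lambda>q. (u q)\<^sup>2 * gibbs V q) \<longleftrightarrow> integrable torus (\<lambda>q. (u q)\<^sup>2)"
    if [measurable]: "u \<in> borel_measurable torus"
  proof
    assume "integrable torus (\<lambda>q. (u q)\<^sup>2 * gibbs V q)"
    then have *: "integrable torus (\<lambda>q. (1 / m) * ((u q)\<^sup>2 * gibbs V q))" by (rule integrable_mult_right)
    show "integrable torus (\<lambda>q. (u q)\<^sup>2)"
    proof (rule Bochner_Integration.integrable_bound[OF *])
      have "m * (u q)\<^sup>2 \<le> (u q)\<^sup>2 * gibbs V q" for q using mult_right_mono[OF m(2)[of q], of "(u q)\<^sup>2"] by (simp add: mult.commute)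
      then have "(u q)\<^sup>2 \<le> (1 / m) * ((u q)\<^sup>2 * gibbs V q)" for q using m(1) by (simp add: field_simps)
      then show "AE q in torus. norm ((u q)\<^sup>2) \<le> norm ((1 / m) * ((u q)\<^sup>2 * gibbs V q))"
        by (intro AE_I2) (smt (verit) real_norm_def zero_le_power2)
    qed measurable
  next
    assume "integrable torus (\<lambda>q. (u q)\<^sup>2)"
    then have *: "integrable torus (\<lambda>q. M * (u q)\<^sup>2)" by (rule integrable_mult_right)
    show "integrable torus (\<lambda>q. (u q)\<^sup>2 * gibbs V q)"
    proof (rule Bochner_Integration.integrable_bound[OF *])
      have "0 \<le> gibbs V q" for q using m(1) m(2)[of q] by simp
      then have "\<bar>(u q)\<^sup>2 * gibbs V q\<bar> \<le> \<bar>M * (u q)\<^sup>2\<bar>" for q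
        using M[of q] by (smt (verit) mult.commute mult_left_mono mult_nonneg_nonneg zero_le_power2)
      then show "AE q in torus. norm ((u q)\<^sup>2 * gibbs V q) \<le> norm (M * (u q)\<^sup>2)" by simp
    qed measurable
  qed
  then show ?thesis unfolding L2_gibbs_def by blast
qed

lemma fourier_coeff_Re_Im:
  assumes "integrable torus u"
  shows "Re (fourier_coeff u k) = (\<integral>q. u q * cos (2 * pi * phase k q) \<partial>torus)"
    "Im (fourier_coeff u k) = - (\<integral>q. u q * sin (2 * pi * phase k q) \<partial>torus)"
proof -
  have "integrable torus (\<lambda>q. of_real (u q) * cnj (torus_char k q))"
    using integrable_mult_torus_char[OF assms, of "- k"] by (simp add: cnj_torus_char)
  then show "Re (fourier_coeff u k) = (\<integral>q. u q * cos (2 * pi * phase k q) \<partial>torus)"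
    "Im (fourier_coeff u k) = - (\<integral>q. u q * sin (2 * pi * phase k q) \<partial>torus)"
    unfolding fourier_coeff_def
    by (auto simp: torus_char_def simp flip: integral_Re integral_Im)
qed

text \<open>Testing the weak gradient against cosine and sine multiplies the coefficient of
  \<open>u\<close> by the imaginary number with imaginary part \<open>2 * pi * k $ i\<close>; only
  the moduli are used later.\<close>

lemma fourier_coeff_weak_gradient:
  fixes u :: "real^'n \<Rightarrow> real"
  assumes V: "V \<in> smooth_torus" and u: "u \<in> L2_gibbs V" and G: "has_weak_gradient V u G"
  shows "(norm (fourier_coeff (\<lambda>q. G q $ i) k))\<^sup>2 =
    4 * pi\<^sup>2 * (of_int (k $ i))\<^sup>2 * (norm (fourier_coeff u k))\<^sup>2"
proof -
  have iu: "integrable torus u"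
    by (rule torus_square_integrable_imp_integrable) (use u in \<open>simp_all add: L2_gibbs_iff[OF V]\<close>)
  have "(\<lambda>q. G q $ i) \<in> L2_gibbs V" using G by (simp add: has_weak_gradient_def)
  then have iG: "integrable torus (\<lambda>q. G q $ i)"
    using torus_square_integrable_imp_integrable unfolding L2_gibbs_iff[OF V] by blast
  have weak: "(\<integral>q. u q * partial_deriv i \<phi> q \<partial>torus) = - (\<integral>q. G q $ i * \<phi> q \<partial>torus)"
    if "\<phi> \<in> smooth_torus" for \<phi> using G that by (simp add: has_weak_gradient_def)
  define K where "K = 2 * pi * of_int (k $ i)"
  have "(\<integral>q. u q * (- K * sin (2 * pi * phase k q)) \<partial>torus) = - (\<integral>q. G q $ i * cos (2 * pi * phase k q) \<partial>torus)"
    using weak[OF smooth_torus_cos_phase[of 1 k 0]]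
    by (simp only: partial_deriv_cos_phase) (simp add: K_def cos_add cos_diff mult.assoc)
  then have 1: "Re (fourier_coeff (\<lambda>q. G q $ i) k) = - K * Im (fourier_coeff u k)"
    by (simp add: fourier_coeff_Re_Im[OF iu] fourier_coeff_Re_Im[OF iG] mult.left_commute[of _ K])
  \<comment> \<open>The phase \<open>- pi / 2\<close> turns the cosine test function into the
    sine.\<close>
  have "(\<integral>q. u q * (K * cos (2 * pi * phase k q)) \<partial>torus) = - (\<integral>q. G q $ i * sin (2 * pi * phase k q) \<partial>torus)"
    using weak[OF smooth_torus_cos_phase[of 1 k "- pi / 2"]]
    by (simp only: partial_deriv_cos_phase) (simp add: K_def cos_add cos_diff mult.assoc)
  then have 2: "Im (fourier_coeff (\<lambda>q. G q $ i) k) = K * Re (fourier_coeff u k)"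
    by (simp add: fourier_coeff_Re_Im[OF iu] fourier_coeff_Re_Im[OF iG] mult.left_commute[of _ K])
  show ?thesis
    by (simp add: cmod_power2 1 2) (simp add: K_def power_mult_distrib algebra_simps)
qed

text \<open>Subtracting the Lebesgue mean removes exactly the coefficient at frequency 0. At every
  other frequency the integer vector \<open>k\<close> has squared length at least 1, so the gradient
  coefficients dominate with constant \<open>4 * pi\<^sup>2\<close>.\<close>

theorem poincare_inequality:
  fixes u :: "real^'n \<Rightarrow> real"
  assumes V: "V \<in> smooth_torus" and u: "u \<in> L2_gibbs V" and G: "has_weak_gradient V u G"
  shows "4 * pi\<^sup>2 * (\<integral>q. (u q - integral\<^sup>L torus u)\<^sup>2 \<partial>torus) \<le> (\<integral>q. (norm (G q))\<^sup>2 \<partial>torus)"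
proof -
  define m where "m = integral\<^sup>L torus u"
  define v where "v q = u q - m" for q
  have u': "u \<in> borel_measurable torus" "integrable torus (\<lambda>q. (u q)\<^sup>2)"
    using u by (simp_all add: L2_gibbs_iff[OF V])
  have G': "(\<lambda>q. G q $ i) \<in> borel_measurable torus" "integrable torus (\<lambda>q. (G q $ i)\<^sup>2)" for i
    using G by (auto simp: has_weak_gradient_def L2_gibbs_iff[OF V])
  have iu: "integrable torus u" using torus_square_integrable_imp_integrable[OF u'] .
  have v': "v \<in> borel_measurable torus" "integrable torus (\<lambda>q. (v q)\<^sup>2)"
    unfolding v_def using integrable_power2_diff[OF u'(1) borel_measurable_const u'(2), of m] u' by auto
  have v_coeff: "fourier_coeff v k = (if k = 0 then 0 else fourier_coeff u k)" for k
  proof -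
    have "integrable torus (\<lambda>q. of_real (u q) * cnj (torus_char k q))"
      using integrable_mult_torus_char[OF iu, of "- k"] by (simp add: cnj_torus_char)
    then have "fourier_coeff v k = fourier_coeff u k - of_real m * (\<integral>q. torus_char (- k) q \<partial>torus)"
      unfolding fourier_coeff_def v_def by (simp add: left_diff_distrib cnj_torus_char)
    moreover have "fourier_coeff u 0 = of_real m"
      unfolding fourier_coeff_def m_def by (simp add: integral_complex_of_real)
    ultimately show ?thesis by (simp add: integral_torus_char)
  qed
  have "(\<integral>q. (v q)\<^sup>2 \<partial>torus) \<le> (\<Sum>i\<in>UNIV. \<integral>q. (G q $ i)\<^sup>2 \<partial>torus) / (4 * pi\<^sup>2)"
  proof (rule L2_le_fourier_coeffs[OF v'])
    fix F :: "(int^'n) set" assume F: "finite F"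
    have "(norm (fourier_coeff v k))\<^sup>2 \<le> (\<Sum>i\<in>UNIV. (norm (fourier_coeff (\<lambda>q. G q $ i) k))\<^sup>2) / (4 * pi\<^sup>2)" for k
    proof (cases "k = 0")
      case True
      then show ?thesis by (simp add: v_coeff sum_nonneg)
    next
      case False
      then obtain j where "k $ j \<noteq> 0" by (auto simp: vec_eq_iff)
      then have "1 \<le> \<bar>real_of_int (k $ j)\<bar>" by linarith
      then have "1 \<le> (real_of_int (k $ j))\<^sup>2" using one_le_power[of "\<bar>real_of_int (k $ j)\<bar>" 2] by simp
      also have "\<dots> \<le> (\<Sum>i\<in>UNIV. (real_of_int (k $ i))\<^sup>2)"
        by (rule member_le_sum) auto
      finally have "(norm (fourier_coeff u k))\<^sup>2 * 1 \<le> (norm (fourier_coeff u k))\<^sup>2 * (\<Sum>i\<in>UNIV. (real_of_int (k $ i))\<^sup>2)"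
        by (intro mult_left_mono) auto
      also have "\<dots> = (\<Sum>i\<in>UNIV. (norm (fourier_coeff (\<lambda>q. G q $ i) k))\<^sup>2) / (4 * pi\<^sup>2)"
        by (simp add: fourier_coeff_weak_gradient[OF V u G] sum_distrib_left sum_divide_distrib mult.commute)
      finally show ?thesis using False by (simp add: v_coeff)
    qed
    then have "(\<Sum>k\<in>F. (norm (fourier_coeff v k))\<^sup>2) \<le>
        (\<Sum>k\<in>F. (\<Sum>i\<in>UNIV. (norm (fourier_coeff (\<lambda>q. G q $ i) k))\<^sup>2) / (4 * pi\<^sup>2))"
      by (rule sum_mono)
    \<comment> \<open>The sums are exchanged so that Bessel's inequality applies to each component
      of the gradient separately.\<close>
    also have "\<dots> = (\<Sum>i\<in>UNIV. \<Sum>k\<in>F. (norm (fourier_coeff (\<lambda>q. G q $ i) k))\<^sup>2) / (4 * pi\<^sup>2)"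
      by (subst sum.swap) (simp flip: sum_divide_distrib)
    also have "\<dots> \<le> (\<Sum>i\<in>UNIV. \<integral>q. (G q $ i)\<^sup>2 \<partial>torus) / (4 * pi\<^sup>2)"
      by (intro divide_right_mono sum_mono bessel_inequality G' F) simp
    finally show "(\<Sum>k\<in>F. (norm (fourier_coeff v k))\<^sup>2) \<le> (\<Sum>i\<in>UNIV. \<integral>q. (G q $ i)\<^sup>2 \<partial>torus) / (4 * pi\<^sup>2)" .
  qed
  also have "(\<Sum>i\<in>UNIV. \<integral>q. (G q $ i)\<^sup>2 \<partial>torus) = (\<integral>q. (norm (G q))\<^sup>2 \<partial>torus)"
  proof -
    have "(norm (G q))\<^sup>2 = (\<Sum>i\<in>UNIV. (G q $ i)\<^sup>2)" for q
      unfolding power2_norm_eq_inner inner_vec_def by (simp add: power2_eq_square)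
    then show ?thesis using G'(2) by (simp add: Bochner_Integration.integral_sum)
  qed
  finally show ?thesis by (simp add: v_def m_def field_simps)
qed

section \<open>Convex families of matrix fields\<close>

text \<open>The infima \<open>m n\<close> of the squared norms increase to a limit \<open>L\<close>.
  For late \<open>i\<close> and \<open>j\<close> the midpoint stays in \<open>S n\<close>, so its
  squared norm is at least \<open>m n\<close>, while those of \<open>s i\<close> and
  \<open>s j\<close> barely exceed \<open>L\<close>; the parallelogram law leaves no room for a
  large difference. Membership of the limit in the sets is not claimed: the caller proves stability
  under a.e. convergence.\<close>

lemma nested_midpoint_convex_AE_Cauchy:
  fixes S :: "nat \<Rightarrow> ('a \<Rightarrow> 'b::euclidean_space) set"
  assumes "prob_space M" and S: "decseq S" "\<And>n. S n \<noteq> {}"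
    and meas: "\<And>n f. f \<in> S n \<Longrightarrow> f \<in> borel_measurable M"
    and bdd: "\<And>n f. f \<in> S n \<Longrightarrow> AE x in M. norm (f x) \<le> B"
    and mid: "\<And>n f g. f \<in> S n \<Longrightarrow> g \<in> S n \<Longrightarrow> (\<lambda>x. (1/2) *\<^sub>R (f x + g x)) \<in> S n"
  obtains s where "\<And>n. s n \<in> S n" "AE x in M. Cauchy (\<lambda>n. s n x)"
proof -
  interpret prob_space M by fact
  define J where "J f = (\<integral>x. (norm (f x))\<^sup>2 \<partial>M)" for f :: "'a \<Rightarrow> 'b"
  define m where "m n = (INF f\<in>S n. J f)" for n
  have B2: "AE x in M. (norm (f x))\<^sup>2 \<le> B\<^sup>2" if "f \<in> S n" for f n
    using bdd[OF that] by eventually_elim (simp add: power_mono)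
  have int: "integrable M (\<lambda>x. (norm (f x))\<^sup>2)" if "f \<in> S n" for f n
    using B2[OF that] meas[OF that] by (intro integrable_const_bound[where B="B\<^sup>2"]) auto
  have int1: "integrable M f" if "f \<in> S n" for f n
    using bdd[OF that] meas[OF that] by (intro integrable_const_bound[where B=B]) auto
  have J0: "0 \<le> J f" for f unfolding J_def by simp
  have JB: "J f \<le> B\<^sup>2" if "f \<in> S n" for f n
  proof -
    have "J f \<le> (\<integral>x. B\<^sup>2 \<partial>M)"
      unfolding J_def using int[OF that] B2[OF that] by (intro integral_mono_AE) auto
    then show ?thesis by (simp add: prob_space)
  qed
  have bb: "bdd_below (J ` S n)" for n using J0 by (intro bdd_belowI[of _ 0]) auto
  have mJ: "m n \<le> J f" if "f \<in> S n" for f n unfolding m_def using bb that by (rule cINF_lower)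
  have "incseq m"
    unfolding incseq_def m_def
  proof (intro allI impI cINF_superset_mono S(2) bb)
    fix i j :: nat assume "i \<le> j"
    then show "S j \<subseteq> S i" using S(1) by (simp add: decseq_def)
  qed simp
  moreover have "m n \<le> B\<^sup>2" for n
    using S(2)[of n] mJ JB order_trans by (metis ex_in_conv)
  ultimately obtain L where L: "m \<longlonglongrightarrow> L" "\<And>n. m n \<le> L"
    using incseq_convergent[of m "B\<^sup>2"] by blast
  have "\<exists>f. f \<in> S n \<and> J f < m n + 1 / real (Suc n)" for n
    using cINF_less_iff[OF S(2) bb, of n "m n + 1 / real (Suc n)"] by (auto simp: m_def)
  then obtain s where s: "\<And>n. s n \<in> S n" "\<And>n. J (s n) < m n + 1 / real (Suc n)" by metis
  have sN: "s i \<in> S n" if "n \<le> i" for i n using s(1)[of i] S(1) that by (auto simp: decseq_def)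
  have close: "(\<integral>x. (norm (s i x - s j x))\<^sup>2 \<partial>M) \<le> 4 * (L - m n) + 4 / real (Suc n)"
    if "n \<le> i" "n \<le> j" for i j n
  proof -
    let ?g = "\<lambda>x. (1/2) *\<^sub>R (s i x + s j x)"
    have gS: "?g \<in> S n" using that by (intro mid sN)
    have par: "(norm (s i x - s j x))\<^sup>2 = 2 * (norm (s i x))\<^sup>2 + 2 * (norm (s j x))\<^sup>2 - 4 * (norm (?g x))\<^sup>2" for x
      unfolding power2_norm_eq_inner by (simp add: inner_simps inner_commute field_simps)
    have "(\<integral>x. (norm (s i x - s j x))\<^sup>2 \<partial>M) = 2 * J (s i) + 2 * J (s j) - 4 * J ?g"
      unfolding par J_def using int[OF s(1)] int[OF gS] by simp
    moreover have "m n \<le> J ?g" by (rule mJ[OF gS])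
    moreover have "J (s k) \<le> L + 1 / real (Suc n)" if "n \<le> k" for k
    proof -
      have "1 / real (Suc k) \<le> 1 / real (Suc n)" using that by (simp add: frac_le)
      then show ?thesis using s(2)[of k] L(2)[of k] by linarith
    qed
    ultimately show ?thesis using that[THEN \<open>\<And>k. n \<le> k \<Longrightarrow> J (s k) \<le> L + 1 / real (Suc n)\<close>] by simp
  qed
  \<comment> \<open>The extraction of an a.e. Cauchy subsequence works with L^1 distances, so the
    L^2 estimate is converted first.\<close>
  have small: "\<exists>N. \<forall>i\<ge>N. \<forall>j\<ge>N. (\<integral>x. norm (s i x - s j x) \<partial>M) < e" if "0 < e" for e
  proof -
    have "(\<lambda>n. 4 * (L - m n) + 4 * (1 / real (Suc n))) \<longlonglongrightarrow> 4 * (L - L) + 4 * 0"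
      by (intro tendsto_intros L(1) LIMSEQ_Suc[OF lim_1_over_n])
    then have "eventually (\<lambda>n. 4 * (L - m n) + 4 * (1 / real (Suc n)) < e\<^sup>2) sequentially"
      using that by (intro order_tendstoD) auto
    then obtain n where n: "4 * (L - m n) + 4 / real (Suc n) < e\<^sup>2" by (auto simp: eventually_sequentially)
    have "(\<integral>x. norm (s i x - s j x) \<partial>M) < e" if "n \<le> i" "n \<le> j" for i j
    proof -
      have sq: "(\<integral>x. (norm (s i x - s j x))\<^sup>2 \<partial>M) < e\<^sup>2" using close[OF that] n by simp
      have i2: "integrable M (\<lambda>x. (norm (s i x - s j x))\<^sup>2)"
      proof (rule Bochner_Integration.integrable_bound[where f="\<lambda>x. 2 * (norm (s i x))\<^sup>2 + 2 * (norm (s j x))\<^sup>2"])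
        have "(norm (s i x - s j x))\<^sup>2 \<le> 2 * (norm (s i x))\<^sup>2 + 2 * (norm (s j x))\<^sup>2" for x
          using inner_ge_zero[of "s i x + s j x"] by (simp add: power2_norm_eq_inner inner_simps inner_commute)
        then show "AE x in M. norm ((norm (s i x - s j x))\<^sup>2) \<le> norm (2 * (norm (s i x))\<^sup>2 + 2 * (norm (s j x))\<^sup>2)"
          by simp
      qed (use int[OF s(1)] meas[OF s(1)] in auto)
      \<comment> \<open>This form of (y - e)^2 \<ge> 0 stands in for Cauchy-Schwarz: a mean square
        below e^2 gives a mean below \<open>e\<close>.\<close>
      have le: "y \<le> e / 2 + (1 / (2 * e)) * y\<^sup>2" for y
        using zero_le_power2[of "y - e"] \<open>0 < e\<close> by (simp add: field_simps power2_eq_square)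
      have "(\<integral>x. norm (s i x - s j x) \<partial>M) \<le> (\<integral>x. e / 2 + (1 / (2 * e)) * (norm (s i x - s j x))\<^sup>2 \<partial>M)"
        using int1[OF s(1)] i2 le by (intro integral_mono) auto
      also have "\<dots> = e / 2 + (1 / (2 * e)) * (\<integral>x. (norm (s i x - s j x))\<^sup>2 \<partial>M)"
        using i2 by (simp add: prob_space)
      also have "\<dots> < e / 2 + (1 / (2 * e)) * e\<^sup>2"
        using sq \<open>0 < e\<close> by (intro add_strict_left_mono mult_strict_left_mono) auto
      also have "\<dots> = e" using \<open>0 < e\<close> by (simp add: field_simps power2_eq_square)
      finally show ?thesis .
    qed
    then show ?thesis by blast
  qed
  obtain r where r: "strict_mono r" "AE x in M. Cauchy (\<lambda>i. s (r i) x)"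
    using cauchy_L1_AE_cauchy_subseq[OF int1[OF s(1)] small] by blast
  show ?thesis
    \<comment> \<open>Since \<open>r n\<close> is at least \<open>n\<close> and the sets decrease,
      \<open>s (r n)\<close> lies in \<open>S n\<close>.\<close>
    by (rule that[of "\<lambda>n. s (r n)"]) (use r sN seq_suble[OF r(1)] in auto)
qed

section \<open>Convexity, closedness and norm bounds for the matrix constraints\<close>

lemma bounded_matrices_midpoint:
  assumes "A \<in> bounded_matrices a b" "B \<in> bounded_matrices a b"
  shows "(1/2) *\<^sub>R (A + B) \<in> bounded_matrices a b"
proof -
  have q: "\<xi> \<bullet> (((1/2) *\<^sub>R (A + B)) *v \<xi>) = (\<xi> \<bullet> (A *v \<xi>) + \<xi> \<bullet> (B *v \<xi>)) / 2" for \<xi>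
    by (simp add: scaleR_matrix_vector_assoc[symmetric] matrix_vector_mult_add_rdistrib inner_add_right)
  have "transpose ((1/2) *\<^sub>R (A + B)) = (1/2) *\<^sub>R (transpose A + transpose B)"
    by (simp add: transpose_def vec_eq_iff)
  then have "psd ((1/2) *\<^sub>R (A + B))"
    using assms unfolding bounded_matrices_def psd_def q by simp
  moreover have "a * (norm \<xi>)\<^sup>2 \<le> (\<xi> \<bullet> (A *v \<xi>) + \<xi> \<bullet> (B *v \<xi>)) / 2" for \<xi>
  proof -
    have "a * (norm \<xi>)\<^sup>2 \<le> \<xi> \<bullet> (A *v \<xi>)" "a * (norm \<xi>)\<^sup>2 \<le> \<xi> \<bullet> (B *v \<xi>)"
      using assms by (simp_all add: bounded_matrices_def)
    then show ?thesis by simp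
  qed
  moreover have "(\<xi> \<bullet> (A *v \<xi>) + \<xi> \<bullet> (B *v \<xi>)) / 2 \<le> 1 / b * (norm \<xi>)\<^sup>2" if "b \<noteq> 0" for \<xi>
  proof -
    have "\<xi> \<bullet> (A *v \<xi>) \<le> 1 / b * (norm \<xi>)\<^sup>2" "\<xi> \<bullet> (B *v \<xi>) \<le> 1 / b * (norm \<xi>)\<^sup>2"
      using assms that unfolding bounded_matrices_def by blast+
    moreover have "(x + y) / 2 \<le> z" if "x \<le> z" "y \<le> z" for x y z :: real using that by simp
    ultimately show ?thesis by blast
  qed
  ultimately show ?thesis unfolding bounded_matrices_def mem_Collect_eq q by blast
qed

lemma tendsto_quadratic_form:
  fixes A :: "nat \<Rightarrow> real^'n^'n"
  assumes "A \<longlonglongrightarrow> L" shows "(\<lambda>n. \<xi> \<bullet> (A n *v \<xi>)) \<longlonglongrightarrow> \<xi> \<bullet> (L *v \<xi>)"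
proof -
  have "(\<lambda>n. A n *v \<xi>) \<longlonglongrightarrow> L *v \<xi>"
    by (rule vec_tendstoI) (auto simp: matrix_vector_mult_def intro!: tendsto_intros assms)
  then show ?thesis by (intro tendsto_intros)
qed

lemma psd_limit:
  assumes "A \<longlonglongrightarrow> L" "\<And>n. psd (A n)" shows "psd L"
proof -
  have "transpose L = L"
  proof -
    have "L $ i $ j = L $ j $ i" for i j
    proof (rule LIMSEQ_unique)
      show "(\<lambda>n. A n $ i $ j) \<longlonglongrightarrow> L $ i $ j" by (intro tendsto_vec_nth assms)
      have "A n $ i $ j = A n $ j $ i" for n
      proof -
        have "transpose (A n) $ i $ j = A n $ i $ j" using assms(2)[of n] by (simp add: psd_def)
        then show ?thesis by (simp add: transpose_def)
      qed
      then show "(\<lambda>n. A n $ i $ j) \<longlonglongrightarrow> L $ j $ i" by (simp add: tendsto_vec_nth assms)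
    qed
    then show ?thesis by (simp add: transpose_def vec_eq_iff)
  qed
  moreover have "0 \<le> \<xi> \<bullet> (L *v \<xi>)" for \<xi>
    using assms(2) by (intro LIMSEQ_le_const[OF tendsto_quadratic_form[OF assms(1)]]) (auto simp: psd_def)
  ultimately show ?thesis by (simp add: psd_def)
qed

lemma bounded_matrices_limit:
  assumes lim: "A \<longlonglongrightarrow> L" and A: "\<And>n. A n \<in> bounded_matrices a b"
  shows "L \<in> bounded_matrices a b"
proof -
  have "psd L" using A by (intro psd_limit[OF lim]) (simp add: bounded_matrices_def)
  moreover have "a * (norm \<xi>)\<^sup>2 \<le> \<xi> \<bullet> (L *v \<xi>)" for \<xi>
    using A by (intro LIMSEQ_le_const[OF tendsto_quadratic_form[OF lim]]) (auto simp: bounded_matrices_def)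
  moreover have "\<xi> \<bullet> (L *v \<xi>) \<le> 1 / b * (norm \<xi>)\<^sup>2" if "b \<noteq> 0" for \<xi>
    using A that by (intro LIMSEQ_le_const2[OF tendsto_quadratic_form[OF lim]]) (auto simp: bounded_matrices_def)
  ultimately show ?thesis by (simp add: bounded_matrices_def)
qed

text \<open>Polarisation: four times an entry of the symmetric matrix is the difference of its
  quadratic form at \<open>x + y\<close> and \<open>x - y\<close> for two basis vectors. Both values
  lie between 0 and \<open>4 / b\<close>, so every entry is at most \<open>1 / b\<close> in
  modulus.\<close>

lemma bounded_matrices_norm_le:
  fixes A :: "real^'n^'n"
  assumes "A \<in> bounded_matrices a b" "0 < b"
  shows "norm A \<le> real CARD('n) * (real CARD('n) * (1 / b))"
proof -
  have entry: "\<bar>A $ i $ j\<bar> \<le> 1 / b" for i j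
  proof -
    define x y :: "real^'n" where "x = axis i 1" and "y = axis j 1"
    have val: "axis k 1 \<bullet> (A *v axis l 1) = A $ k $ l" for k l
      by (simp add: inner_axis' matrix_vector_mult_basis column_def)
    have "transpose A $ i $ j = A $ i $ j" using assms(1) by (simp add: bounded_matrices_def psd_def)
    then have sym: "y \<bullet> (A *v x) = x \<bullet> (A *v y)" by (simp add: val x_def y_def transpose_def)
    have Q: "0 \<le> \<xi> \<bullet> (A *v \<xi>)" "\<xi> \<bullet> (A *v \<xi>) \<le> 1 / b * 4" if "norm \<xi> \<le> 2" for \<xi>
    proof -
      have "(norm \<xi>)\<^sup>2 \<le> 2\<^sup>2" using that by (intro power_mono) auto
      then have "1 / b * (norm \<xi>)\<^sup>2 \<le> 1 / b * 4" using assms(2) by (intro mult_left_mono) auto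
      then show "\<xi> \<bullet> (A *v \<xi>) \<le> 1 / b * 4"
        using assms unfolding bounded_matrices_def by (smt (verit) mem_Collect_eq)
      show "0 \<le> \<xi> \<bullet> (A *v \<xi>)" using assms(1) by (simp add: bounded_matrices_def psd_def)
    qed
    have n: "norm (x + y) \<le> 2" "norm (x - y) \<le> 2"
      using norm_triangle_ineq[of x y] norm_triangle_ineq4[of x y] by (auto simp: x_def y_def)
    have "4 * A $ i $ j = (x + y) \<bullet> (A *v (x + y)) - (x - y) \<bullet> (A *v (x - y))"
      using sym val[of i j] unfolding x_def[symmetric] y_def[symmetric] by (simp add: inner_simps matrix_vector_right_distrib matrix_vector_mult_diff_distrib)
    then show ?thesis using Q[OF n(1)] Q[OF n(2)] by linarith
  qed
  have "norm (A $ i) \<le> real CARD('n) * (1 / b)" for i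
  proof -
    have "norm (A $ i) \<le> (\<Sum>j\<in>UNIV. \<bar>A $ i $ j\<bar>)" by (rule norm_le_l1_cart)
    also have "\<dots> \<le> (\<Sum>j\<in>(UNIV::'n set). 1 / b)" by (intro sum_mono entry)
    finally show ?thesis by simp
  qed
  then have "(\<Sum>i\<in>UNIV. norm (A $ i)) \<le> (\<Sum>i\<in>(UNIV::'n set). real CARD('n) * (1 / b))" by (intro sum_mono)
  moreover have "norm A \<le> (\<Sum>i\<in>UNIV. norm (A $ i))" unfolding norm_vec_def by (intro L2_set_le_sum) auto
  ultimately show ?thesis by simp
qed

lemma matrix_norm_midpoint:
  assumes "matrix_norm N" shows "N ((1/2) *\<^sub>R (A + B)) \<le> (N A + N B) / 2"
proof -
  have "N ((1/2) *\<^sub>R (A + B)) = \<bar>1/2\<bar> * N (A + B)" using assms unfolding matrix_norm_def by blast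
  also have "\<dots> \<le> \<bar>1/2\<bar> * (N A + N B)" using assms unfolding matrix_norm_def by (intro mult_left_mono) auto
  finally show ?thesis by simp
qed

text \<open>The norm is arbitrary; its continuity comes from convexity on a finite-dimensional
  space.\<close>

lemma matrix_norm_continuous:
  fixes N :: "real^'n^'n \<Rightarrow> real"
  assumes "matrix_norm N" shows "continuous_on UNIV N"
proof (rule convex_on_continuous)
  have "N (u *\<^sub>R A + v *\<^sub>R B) \<le> u * N A + v * N B" if "0 \<le> u" "0 \<le> v" for u v A B
  proof -
    have "N (u *\<^sub>R A + v *\<^sub>R B) \<le> N (u *\<^sub>R A) + N (v *\<^sub>R B)" using assms unfolding matrix_norm_def by blast
    also have "\<dots> = \<bar>u\<bar> * N A + \<bar>v\<bar> * N B" using assms unfolding matrix_norm_def by metis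
    finally show ?thesis using that by simp
  qed
  then show "convex_on UNIV N" by (auto simp: convex_on_def)
qed simp

lemma powr_midpoint:
  fixes x y p :: real
  assumes "1 \<le> p" "0 \<le> x" "0 \<le> y"
  shows "((x + y) / 2) powr p \<le> (x powr p + y powr p) / 2"
proof -
  \<comment> \<open>Convexity is invoked below for positive arguments; this bound settles the case
    in which one of them is 0.\<close>
  have half: "(z / 2) powr p \<le> z powr p / 2" if "0 \<le> z" for z
  proof -
    have "(1/2::real) powr p \<le> (1/2) powr 1" using assms(1) by (intro powr_mono') auto
    then have "z powr p * (1/2) powr p \<le> z powr p * (1/2)" by (intro mult_left_mono) auto
    then show ?thesis using powr_mult[of z "1/2" p] by simp
  qed
  show ?thesis
  proof (cases "x = 0 \<or> y = 0")
    case True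
    then show ?thesis using half[OF assms(2)] half[OF assms(3)] assms(1) by auto
  next
    case False
    then have "((1 - 1/2) *\<^sub>R x + (1/2) *\<^sub>R y) powr p \<le> (1 - 1/2) * x powr p + (1/2) * y powr p"
      using assms by (intro convex_onD[OF powr_convex]) auto
    moreover have "(1 - 1/2) *\<^sub>R x + (1/2) *\<^sub>R y = (x + y) / 2" by simp
    ultimately show ?thesis by (simp only:) simp
  qed
qed

section \<open>Existence of a maximiser\<close>

text \<open>The weighted field $e^{-V} D$, to which the constraints on $D$ refer.\<close>

definition weighted :: "(real^'n \<Rightarrow> real) \<Rightarrow> (real^'n \<Rightarrow> real^'n^'n) \<Rightarrow> real^'n \<Rightarrow> real^'n^'n" where
  "weighted V D q = exp (- V q) *\<^sub>R D q"

lemma borel_measurable_weighted: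
  assumes "V \<in> smooth_torus" "D \<in> borel_measurable torus"
  shows "weighted V D \<in> borel_measurable torus"
proof -
  have "(\<lambda>q. exp (- V q)) \<in> borel_measurable torus"
    by (intro borel_measurable_continuous_torus continuous_intros smooth_torus_continuous assms)
  then show ?thesis unfolding weighted_def using assms(2) by measurable
qed

lemma weighted_midpoint:
  "weighted V (\<lambda>q. (1/2) *\<^sub>R (D q + E q)) = (\<lambda>q. (1/2) *\<^sub>R (weighted V D q + weighted V E q))"
  by (simp add: weighted_def fun_eq_iff scaleR_add_right)

lemma matrix_norm_bounded_matrices:
  fixes N :: "real^'n^'n \<Rightarrow> real"
  assumes "matrix_norm N" "0 < b"
  obtains K where "0 < K" "\<And>A. A \<in> bounded_matrices a b \<Longrightarrow> N A \<le> K"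
proof -
  define C where "C = real CARD('n) * (real CARD('n) * (1 / b))"
  have "compact (N ` cball 0 C)"
    by (intro compact_continuous_image continuous_on_subset[OF matrix_norm_continuous[OF assms(1)]]) auto
  then obtain K where K: "0 < K" "\<forall>x\<in>N ` cball 0 C. norm x \<le> K"
    using bounded_pos compact_imp_bounded by blast
  have "N A \<le> K" if "A \<in> bounded_matrices a b" for A
  proof -
    have "A \<in> cball 0 C" using bounded_matrices_norm_le[OF that assms(2)] by (simp add: C_def)
    then have "norm (N A) \<le> K" using K(2) by blast
    then show ?thesis by simp
  qed
  then show ?thesis using that K(1) by blast
qed

text \<open>By homogeneity of \<open>N\<close> the exponential weight moves inside the norm, so the
  a.e. and integral constraints concern \<open>weighted V D\<close>. Finiteness of the essential
  supremum comes from the bound \<open>1 / b\<close>, and comparing with 1 is insensitive to the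
  outer power \<open>1 / p\<close>.\<close>

lemma diffusions_iff:
  fixes V :: "real^'n \<Rightarrow> real" and N :: "real^'n^'n \<Rightarrow> real"
  assumes V: "V \<in> smooth_torus" and N: "matrix_norm N" and "1 \<le> p" "0 < b"
  shows "D \<in> diffusions N V p a b \<longleftrightarrow>
    Z_periodic D \<and> D \<in> borel_measurable torus \<and> (\<forall>q. psd (D q)) \<and>
    (AE q in torus. weighted V D q \<in> bounded_matrices a b) \<and>
    (\<integral>q. N (weighted V D q) powr p \<partial>torus) \<le> 1"
proof -
  have Nw: "N (weighted V D q) = N (D q) * exp (- V q)" for q
  proof -
    have "N (weighted V D q) = \<bar>exp (- V q)\<bar> * N (D q)"
      using N unfolding matrix_norm_def weighted_def by blast
    then show ?thesis by simp
  qed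
  have N0: "0 \<le> N A" for A using N by (simp add: matrix_norm_def)
  have powr: "N (D q) powr p * exp (- p * V q) = N (weighted V D q) powr p" for q
    using N0 by (simp add: Nw powr_mult exp_powr_real mult.commute)
  have I: "I powr (1 / p) \<le> 1 \<longleftrightarrow> I \<le> 1" if "0 \<le> I" for I
  proof
    assume "I \<le> 1" then show "I powr (1 / p) \<le> 1" using that assms(3) by (intro powr_le1) auto
  next
    assume *: "I powr (1 / p) \<le> 1"
    show "I \<le> 1"
    proof (rule ccontr)
      assume "\<not> I \<le> 1"
      then have "1 powr (1 / p) < I powr (1 / p)" using assms(3) by (intro powr_less_mono2) auto
      then show False using * by simp
    qed
  qed
  have Lp: "Lp_norm N V p D \<le> 1 \<longleftrightarrow> (\<integral>q. N (weighted V D q) powr p \<partial>torus) \<le> 1"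
    unfolding Lp_norm_def powr by (intro I) simp
  have Linf: "Linf_norm N V D < \<infinity>" if D: "D \<in> borel_measurable torus"
    and bm: "AE q in torus. weighted V D q \<in> bounded_matrices a b"
  proof -
    obtain K where K: "\<And>A. A \<in> bounded_matrices a b \<Longrightarrow> N A \<le> K"
      using matrix_norm_bounded_matrices[OF N assms(4)] by blast
    have "(\<lambda>q. N (weighted V D q)) \<in> borel_measurable torus"
      using borel_measurable_continuous_onI[OF matrix_norm_continuous[OF N]] borel_measurable_weighted[OF V D]
      by (rule measurable_compose_rev)
    then have "esssup torus (\<lambda>q. ereal (N (D q) * exp (- V q))) \<le> ereal K"
      unfolding Nw[symmetric] using bm K by (intro esssup_I) (auto elim!: eventually_mono)
    then show ?thesis unfolding Linf_norm_def by (rule order.strict_trans1) simp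
  qed
  show ?thesis
    unfolding diffusions_def mem_Collect_eq Lp using Linf by (auto simp: weighted_def[abs_def])
qed

lemma matrix_norm_powr_integrable:
  fixes N :: "real^'n^'n \<Rightarrow> real"
  assumes "matrix_norm N" "1 \<le> p" and "f \<in> borel_measurable (torus :: (real^'n) measure)"
    and "AE q in torus. N (f q) \<le> K"
  shows "integrable torus (\<lambda>q. N (f q) powr p)"
proof (rule torus.integrable_const_bound[where B="K powr p"])
  have N0: "0 \<le> N A" for A using assms(1) by (simp add: matrix_norm_def)
  show "AE q in torus. norm (N (f q) powr p) \<le> K powr p"
    using assms(4)
    by eventually_elim (use N0 assms(2) in \<open>simp add: powr_mono2\<close>)
  have "(\<lambda>q. N (f q)) \<in> borel_measurable torus"
    using borel_measurable_continuous_onI[OF matrix_norm_continuous[OF assms(1)]] assms(3)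
    by (rule measurable_compose_rev)
  then show "(\<lambda>q. N (f q) powr p) \<in> borel_measurable torus" by measurable
qed

text \<open>The integral constraint is convex: the triangle inequality for \<open>N\<close> and
  convexity of the \<open>p\<close>-th power give a pointwise estimate, which is then
  integrated.\<close>

lemma diffusions_midpoint:
  fixes V :: "real^'n \<Rightarrow> real" and N :: "real^'n^'n \<Rightarrow> real"
  assumes V: "V \<in> smooth_torus" and N: "matrix_norm N" and p: "1 \<le> p" and b: "0 < b"
    and D: "D \<in> diffusions N V p a b" and E: "E \<in> diffusions N V p a b"
  shows "(\<lambda>q. (1/2) *\<^sub>R (D q + E q)) \<in> diffusions N V p a b"
proof -
  note iff = diffusions_iff[OF V N p b]
  note D' = D[unfolded iff] and E' = E[unfolded iff]
  have N0: "0 \<le> N A" for A using N by (simp add: matrix_norm_def)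
  obtain K where K: "\<And>A. A \<in> bounded_matrices a b \<Longrightarrow> N A \<le> K"
    using matrix_norm_bounded_matrices[OF N b] by blast
  have int: "integrable torus (\<lambda>q. N (weighted V F q) powr p)" if "F \<in> diffusions N V p a b" for F
    using that[unfolded iff] K
    by (intro matrix_norm_powr_integrable[where K=K] N p borel_measurable_weighted V) (auto elim!: eventually_mono)
  have psd: "psd ((1/2) *\<^sub>R (D q + E q))" for q
  proof -
    have q: "\<xi> \<bullet> (((1/2) *\<^sub>R (D q + E q)) *v \<xi>) = (\<xi> \<bullet> (D q *v \<xi>) + \<xi> \<bullet> (E q *v \<xi>)) / 2" for \<xi>
      by (simp add: scaleR_matrix_vector_assoc[symmetric] matrix_vector_mult_add_rdistrib inner_add_right)
    have "transpose ((1/2) *\<^sub>R (D q + E q)) = (1/2) *\<^sub>R (transpose (D q) + transpose (E q))"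
      by (simp add: transpose_def vec_eq_iff)
    then show ?thesis using D' E' unfolding psd_def q by simp
  qed
  have bm: "AE q in torus. weighted V (\<lambda>q. (1/2) *\<^sub>R (D q + E q)) q \<in> bounded_matrices a b"
  proof -
    have "AE q in torus. weighted V D q \<in> bounded_matrices a b" "AE q in torus. weighted V E q \<in> bounded_matrices a b"
      using D' E' by auto
    then show ?thesis unfolding weighted_midpoint by eventually_elim (rule bounded_matrices_midpoint)
  qed
  have meas: "(\<lambda>q. (1/2) *\<^sub>R (D q + E q)) \<in> borel_measurable torus" using D' E' by auto
  have "(\<integral>q. N (weighted V (\<lambda>q. (1/2) *\<^sub>R (D q + E q)) q) powr p \<partial>torus) \<le>
      (\<integral>q. (N (weighted V D q) powr p + N (weighted V E q) powr p) / 2 \<partial>torus)"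
  proof (rule integral_mono)
    show "integrable torus (\<lambda>q. N (weighted V (\<lambda>q. (1/2) *\<^sub>R (D q + E q)) q) powr p)"
      using bm K by (intro matrix_norm_powr_integrable[where K=K] N p borel_measurable_weighted V meas) (auto elim!: eventually_mono)
    show "integrable torus (\<lambda>q. (N (weighted V D q) powr p + N (weighted V E q) powr p) / 2)"
      using int D E by simp
    show "N (weighted V (\<lambda>q. (1/2) *\<^sub>R (D q + E q)) q) powr p \<le> (N (weighted V D q) powr p + N (weighted V E q) powr p) / 2" for q
    proof -
      have "N (weighted V (\<lambda>q. (1/2) *\<^sub>R (D q + E q)) q) powr p \<le> ((N (weighted V D q) + N (weighted V E q)) / 2) powr p"
        unfolding weighted_midpoint using matrix_norm_midpoint[OF N] N0 p by (intro powr_mono2) auto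
      also have "\<dots> \<le> (N (weighted V D q) powr p + N (weighted V E q) powr p) / 2"
        using N0 p by (intro powr_midpoint)
      finally show ?thesis .
    qed
  qed
  also have "\<dots> = ((\<integral>q. N (weighted V D q) powr p \<partial>torus) + (\<integral>q. N (weighted V E q) powr p \<partial>torus)) / 2"
    using int D E by simp
  also have "\<dots> \<le> 1" using D' E' by simp
  finally show ?thesis
    using D' E' psd bm meas unfolding iff by (simp add: Z_periodic_def)
qed

section \<open>Energies and Rayleigh quotients\<close>

definition energy :: "(real^'n \<Rightarrow> real) \<Rightarrow> (real^'n \<Rightarrow> real^'n^'n) \<Rightarrow> (real^'n \<Rightarrow> real^'n) \<Rightarrow> real^'n \<Rightarrow> real" where
  "energy V D G q = (G q \<bullet> (D q *v G q)) * gibbs V q"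

text \<open>The exponential in the Gibbs density is absorbed into the weighted field, leaving only
  the normalising constant. Convergence and bounds of \<open>weighted V D\<close> therefore transfer
  directly to energies.\<close>

lemma energy_weighted: "energy V D G q = (G q \<bullet> (weighted V D q *v G q)) / partition_const V"
  by (simp add: energy_def weighted_def gibbs_def scaleR_matrix_vector_assoc[symmetric])

lemma gradient_integrable:
  fixes V :: "real^'n \<Rightarrow> real"
  assumes V: "V \<in> smooth_torus" and G: "has_weak_gradient V u G"
  shows "\<And>i. (\<lambda>q. G q $ i) \<in> borel_measurable torus" "integrable torus (\<lambda>q. (norm (G q))\<^sup>2)"
proof -
  have *: "(\<lambda>q. G q $ i) \<in> borel_measurable torus" "integrable torus (\<lambda>q. (G q $ i)\<^sup>2)" for i
    using G by (auto simp: has_weak_gradient_def L2_gibbs_iff[OF V])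
  then show "(\<lambda>q. G q $ i) \<in> borel_measurable torus" for i by blast
  have "(norm (G q))\<^sup>2 = (\<Sum>i\<in>UNIV. (G q $ i)\<^sup>2)" for q
    unfolding power2_norm_eq_inner inner_vec_def by (simp add: power2_eq_square)
  then show "integrable torus (\<lambda>q. (norm (G q))\<^sup>2)" using *(2) by simp
qed

lemma borel_measurable_energy:
  fixes V :: "real^'n \<Rightarrow> real"
  assumes V: "V \<in> smooth_torus" and G: "has_weak_gradient V u G" and D: "D \<in> borel_measurable torus"
  shows "energy V D G \<in> borel_measurable torus"
proof -
  have [measurable]: "(\<lambda>q. G q $ i) \<in> borel_measurable torus" for i using gradient_integrable[OF V G] by blast
  have "(\<lambda>A::real^'n^'n. A $ i $ j) \<in> borel_measurable borel" for i j
    by (intro borel_measurable_continuous_onI continuous_intros)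
  then have [measurable]: "(\<lambda>q. D q $ i $ j) \<in> borel_measurable torus" for i j
    using D by (rule measurable_compose_rev)
  note [measurable] = borel_measurable_gibbs[OF V]
  have "energy V D G = (\<lambda>q. (\<Sum>i\<in>UNIV. G q $ i * (\<Sum>j\<in>UNIV. D q $ i $ j * G q $ j)) * gibbs V q)"
    by (simp add: energy_def fun_eq_iff inner_vec_def matrix_vector_mult_def)
  then show ?thesis by simp
qed

text \<open>The bound is independent of \<open>D\<close>; it is the dominating function for limits
  along sequences of fields.\<close>

lemma energy_bound:
  assumes V: "V \<in> smooth_torus" and b: "0 < b" and "weighted V D q \<in> bounded_matrices a b"
  shows "norm (energy V D G q) \<le> (norm (G q))\<^sup>2 / (b * partition_const V)"
proof -
  have "0 \<le> G q \<bullet> (weighted V D q *v G q)" "G q \<bullet> (weighted V D q *v G q) \<le> 1 / b * (norm (G q))\<^sup>2"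
    using assms unfolding bounded_matrices_def psd_def by force+
  then have "(G q \<bullet> (weighted V D q *v G q)) / partition_const V \<le> (1 / b * (norm (G q))\<^sup>2) / partition_const V"
    using partition_const_pos[OF V] by (intro divide_right_mono) auto
  then show ?thesis
    using \<open>0 \<le> G q \<bullet> (weighted V D q *v G q)\<close> partition_const_pos[OF V] unfolding energy_weighted by simp
qed

lemma integrable_energy:
  fixes V :: "real^'n \<Rightarrow> real"
  assumes V: "V \<in> smooth_torus" and N: "matrix_norm N" and p: "1 \<le> p" and b: "0 < b"
    and D: "D \<in> diffusions N V p a b" and G: "has_weak_gradient V u G"
  shows "integrable torus (energy V D G)"
proof (rule Bochner_Integration.integrable_bound)
  note D' = D[unfolded diffusions_iff[OF V N p b]]
  show "integrable torus (\<lambda>q. (norm (G q))\<^sup>2 / (b * partition_const V))"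
    using gradient_integrable[OF V G] by simp
  show "energy V D G \<in> borel_measurable torus" using D' by (intro borel_measurable_energy[OF V G]) simp
  have "AE q in torus. weighted V D q \<in> bounded_matrices a b" using D' by simp
  then show "AE q in torus. norm (energy V D G q) \<le> norm ((norm (G q))\<^sup>2 / (b * partition_const V))"
  proof eventually_elim
    case (elim q)
    then show ?case using energy_bound[OF V b elim, of G] by (metis abs_ge_self order_trans real_norm_def)
  qed
qed

text \<open>Turns a lower bound on the infimum into one condition per test pair, each affine in
  \<open>D\<close>; convexity and passage to the limit are checked in this form.\<close>

lemma le_spectral_gap_iff:
  "c \<le> spectral_gap V D \<longleftrightarrow>
    (\<forall>u G. u \<in> H1_zero_mean V \<and> \<not> (AE q in torus. u q = 0) \<and> has_weak_gradient V u G \<longrightarrow>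
      c \<le> ereal (integral\<^sup>L torus (energy V D G) / (\<integral>q. (u q)\<^sup>2 * gibbs V q \<partial>torus)))"
  unfolding spectral_gap_def le_INF_iff energy_def[abs_def] by auto

lemma spectral_gap_midpoint:
  fixes V :: "real^'n \<Rightarrow> real" and N :: "real^'n^'n \<Rightarrow> real"
  assumes V: "V \<in> smooth_torus" and N: "matrix_norm N" and p: "1 \<le> p" and b: "0 < b"
    and D: "D \<in> diffusions N V p a b" and E: "E \<in> diffusions N V p a b"
    and cD: "c \<le> spectral_gap V D" and cE: "c \<le> spectral_gap V E"
  shows "c \<le> spectral_gap V (\<lambda>q. (1/2) *\<^sub>R (D q + E q))"
  unfolding le_spectral_gap_iff
proof (intro allI impI, elim conjE)
  fix u G assume u: "u \<in> H1_zero_mean V" "\<not> (AE q in torus. u q = 0)" and G: "has_weak_gradient V u G"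
  define I where "I D = integral\<^sup>L torus (energy V D G) / (\<integral>q. (u q)\<^sup>2 * gibbs V q \<partial>torus)" for D
  have "energy V (\<lambda>q. (1/2) *\<^sub>R (D q + E q)) G = (\<lambda>q. (energy V D G q + energy V E G q) / 2)"
    by (simp add: energy_def fun_eq_iff scaleR_matrix_vector_assoc[symmetric]
        matrix_vector_mult_add_rdistrib inner_add_right algebra_simps)
  then have "integral\<^sup>L torus (energy V (\<lambda>q. (1/2) *\<^sub>R (D q + E q)) G) =
      (integral\<^sup>L torus (energy V D G) + integral\<^sup>L torus (energy V E G)) / 2"
    using integrable_energy[OF V N p b D G] integrable_energy[OF V N p b E G] by simp
  then have eq: "I (\<lambda>q. (1/2) *\<^sub>R (D q + E q)) = (I D + I E) / 2"
    by (simp add: I_def add_divide_distrib)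
  have "c \<le> ereal (I D)" "c \<le> ereal (I E)"
    using cD cE u G unfolding le_spectral_gap_iff I_def by blast+
  \<comment> \<open>The average is at least the smaller of the two quotients. Comparing real numbers
    this way avoids arithmetic with \<open>c\<close>, which may be infinite.\<close>
  moreover have "I D \<le> (I D + I E) / 2 \<or> I E \<le> (I D + I E) / 2" by (cases "I D \<le> I E") auto
  ultimately have "c \<le> ereal (I (\<lambda>q. (1/2) *\<^sub>R (D q + E q)))"
    unfolding eq using order_trans ereal_less_eq(3) by blast
  then show "c \<le> ereal (integral\<^sup>L torus (energy V (\<lambda>q. (1/2) *\<^sub>R (D q + E q)) G) / (\<integral>q. (u q)\<^sup>2 * gibbs V q \<partial>torus))"
    unfolding I_def .
qed

text \<open>Supplies the closedness that completes the minimal-norm argument. The a.e. bounds pass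
  to the limit pointwise, the integral constraint and the energies by dominated convergence;
  \<open>incseq c\<close> lets each fixed \<open>c k\<close> bound all late quotients.\<close>

lemma diffusions_limit:
  fixes V :: "real^'n \<Rightarrow> real" and N :: "real^'n^'n \<Rightarrow> real"
  assumes V: "V \<in> smooth_torus" and N: "matrix_norm N" and p: "1 \<le> p" and b: "0 < b"
    and Dn: "\<And>n. D n \<in> diffusions N V p a b"
    and cauchy: "AE q in torus. Cauchy (\<lambda>n. weighted V (D n) q)"
    and c: "incseq c" "\<And>n. c n \<le> spectral_gap V (D n)"
  obtains L where "L \<in> diffusions N V p a b" "\<And>n. c n \<le> spectral_gap V L"
proof -
  note iff = diffusions_iff[OF V N p b]
  note Dn' = Dn[unfolded iff]
  have N0: "0 \<le> N A" for A using N by (simp add: matrix_norm_def)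
  obtain K where K: "\<And>A. A \<in> bounded_matrices a b \<Longrightarrow> N A \<le> K"
    using matrix_norm_bounded_matrices[OF N b] by blast
  \<comment> \<open>Periodicity and positive semidefiniteness are demanded at every point, not
    merely a.e. Hence the limit is taken of \<open>D n\<close> itself wherever it exists, and is 0
    elsewhere; the set of such points is periodic.\<close>
  define L where "L q = (if Cauchy (\<lambda>n. D n q) then lim (\<lambda>n. D n q) else 0)" for q
  have L_lim: "(\<lambda>n. if Cauchy (\<lambda>n. D n q) then D n q else 0) \<longlonglongrightarrow> L q" for q
    using Cauchy_convergent_iff convergent_LIMSEQ_iff by (auto simp: L_def)
  have [measurable]: "D n \<in> borel_measurable torus" for n using Dn' by blast
  have L_meas: "L \<in> borel_measurable torus"
  proof (rule borel_measurable_LIMSEQ_metric[OF _ L_lim])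
    show "(\<lambda>q. if Cauchy (\<lambda>n. D n q) then D n q else 0) \<in> borel_measurable torus" for n by measurable
  qed
  have L_psd: "psd (L q)" for q
  proof (rule psd_limit[OF L_lim])
    have "psd (D n q)" "psd (0 :: real^'n^'n)" for n
      using Dn' by (auto simp: psd_def transpose_def vec_eq_iff)
    then show "psd (if Cauchy (\<lambda>n. D n q) then D n q else 0)" for n by simp
  qed
  have L_per: "Z_periodic L" using Dn' by (simp add: Z_periodic_def L_def)
  have "AE q in torus. (\<lambda>n. weighted V (D n) q) \<longlonglongrightarrow> weighted V L q"
    using cauchy
  proof eventually_elim
    case (elim q)
    \<comment> \<open>Undoing the weight at a fixed point is multiplication by a constant, which
      preserves the Cauchy property.\<close>
    have "D n q = exp (V q) *\<^sub>R weighted V (D n) q" for n by (simp add: weighted_def flip: exp_add)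
    moreover have "Cauchy (\<lambda>n. exp (V q) *\<^sub>R weighted V (D n) q)"
      by (rule bounded_linear.Cauchy[OF bounded_linear_scaleR_right elim])
    ultimately have "Cauchy (\<lambda>n. D n q)" by simp
    then have "(\<lambda>n. D n q) \<longlonglongrightarrow> L q" using L_lim[of q] by simp
    then show ?case unfolding weighted_def by (intro tendsto_intros)
  qed
  moreover have "AE q in torus. \<forall>n. weighted V (D n) q \<in> bounded_matrices a b"
    using Dn' by (simp add: AE_all_countable)
  ultimately have good: "AE q in torus. (\<lambda>n. weighted V (D n) q) \<longlonglongrightarrow> weighted V L q \<and>
      (\<forall>n. weighted V (D n) q \<in> bounded_matrices a b) \<and> weighted V L q \<in> bounded_matrices a b"
    by eventually_elim (auto intro: bounded_matrices_limit)
  have N_meas: "(\<lambda>q. N (weighted V F q) powr p) \<in> borel_measurable torus" if "F \<in> borel_measurable torus" for F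
  proof -
    have "(\<lambda>q. N (weighted V F q)) \<in> borel_measurable torus"
      using borel_measurable_continuous_onI[OF matrix_norm_continuous[OF N]] borel_measurable_weighted[OF V that]
      by (rule measurable_compose_rev)
    then show ?thesis by measurable
  qed
  have "(\<integral>q. N (weighted V L q) powr p \<partial>torus) \<le> 1"
  proof (rule LIMSEQ_le_const2)
    show "(\<lambda>n. \<integral>q. N (weighted V (D n) q) powr p \<partial>torus) \<longlonglongrightarrow> (\<integral>q. N (weighted V L q) powr p \<partial>torus)"
    proof (rule integral_dominated_convergence[where w="\<lambda>_. K powr p"])
      show "AE q in torus. (\<lambda>n. N (weighted V (D n) q) powr p) \<longlonglongrightarrow> N (weighted V L q) powr p"
        using good
      proof eventually_elim
        case (elim q)
        have "isCont N (weighted V L q)"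
          using matrix_norm_continuous[OF N] by (simp add: continuous_on_eq_continuous_at)
        then have "(\<lambda>n. N (weighted V (D n) q)) \<longlonglongrightarrow> N (weighted V L q)"
          by (rule isCont_tendsto_compose) (use elim in blast)
        then show ?case using N0 p by (intro tendsto_powr2) auto
      qed
      show "AE q in torus. norm (N (weighted V (D n) q) powr p) \<le> K powr p" for n
        using good by eventually_elim (use N0 K p in \<open>simp add: powr_mono2\<close>)
    qed (use N_meas L_meas in auto)
    show "\<exists>M. \<forall>n\<ge>M. (\<integral>q. N (weighted V (D n) q) powr p \<partial>torus) \<le> 1" using Dn' by auto
  qed
  then have L: "L \<in> diffusions N V p a b"
    unfolding iff using L_per L_meas L_psd good by auto
  have "c k \<le> spectral_gap V L" for k
    unfolding le_spectral_gap_iff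
  proof (intro allI impI, elim conjE)
    fix u G assume u: "u \<in> H1_zero_mean V" "\<not> (AE q in torus. u q = 0)" and G: "has_weak_gradient V u G"
    have "(\<lambda>n. integral\<^sup>L torus (energy V (D n) G)) \<longlonglongrightarrow> integral\<^sup>L torus (energy V L G)"
    proof (rule integral_dominated_convergence[where w="\<lambda>q. (norm (G q))\<^sup>2 / (b * partition_const V)"])
      show "AE q in torus. (\<lambda>n. energy V (D n) G q) \<longlonglongrightarrow> energy V L G q"
        using good
      proof eventually_elim
        case (elim q)
        then have "(\<lambda>n. G q \<bullet> (weighted V (D n) q *v G q)) \<longlonglongrightarrow> G q \<bullet> (weighted V L q *v G q)"
          by (intro tendsto_quadratic_form) simp
        then show ?case
          unfolding energy_weighted using partition_const_pos[OF V] by (intro tendsto_divide tendsto_const) auto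
      qed
      show "AE q in torus. norm (energy V (D n) G q) \<le> (norm (G q))\<^sup>2 / (b * partition_const V)" for n
        using good by eventually_elim (blast intro: energy_bound[OF V b])
      show "integrable torus (\<lambda>q. (norm (G q))\<^sup>2 / (b * partition_const V))"
        using gradient_integrable[OF V G] by simp
    qed (auto intro!: borel_measurable_energy[OF V G] L_meas)
    then have lim: "(\<lambda>n. ereal (integral\<^sup>L torus (energy V (D n) G) / (\<integral>q. (u q)\<^sup>2 * gibbs V q \<partial>torus)))
        \<longlonglongrightarrow> ereal (integral\<^sup>L torus (energy V L G) / (\<integral>q. (u q)\<^sup>2 * gibbs V q \<partial>torus))"
      unfolding lim_ereal divide_inverse by (intro tendsto_mult tendsto_const)
    show "c k \<le> ereal (integral\<^sup>L torus (energy V L G) / (\<integral>q. (u q)\<^sup>2 * gibbs V q \<partial>torus))"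
    proof (rule LIMSEQ_le_const[OF lim], intro exI[of _ k] allI impI)
      fix n assume "k \<le> n"
      then have "c k \<le> spectral_gap V (D n)" using c order_trans by (metis incseq_def)
      then show "c k \<le> ereal (integral\<^sup>L torus (energy V (D n) G) / (\<integral>q. (u q)\<^sup>2 * gibbs V q \<partial>torus))"
        using u G unfolding le_spectral_gap_iff by blast
    qed
  qed
  then show ?thesis using that L by blast
qed

theorem optimal_diffusion_exists:
  fixes V :: "real^'n \<Rightarrow> real" and N :: "real^'n^'n \<Rightarrow> real"
  assumes V: "V \<in> smooth_torus" and N: "matrix_norm N" and p: "1 \<le> p" and b: "0 < b"
    and ne: "diffusions N V p a b \<noteq> {}"
  shows "\<exists>D. is_optimal N V p a b D"
proof -
  let ?D = "diffusions N V p a b"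
  have "spectral_gap V ` ?D \<noteq> {}" using ne by simp
  \<comment> \<open>Every \<open>c n\<close> is the gap of some admissible field, which makes the
    superlevel sets \<open>S n\<close> below nonempty.\<close>
  then obtain c :: "nat \<Rightarrow> ereal" where c: "incseq c" "range c \<subseteq> spectral_gap V ` ?D"
    "Sup (spectral_gap V ` ?D) = (SUP n. c n)"
    using Sup_countable_SUP[of "spectral_gap V ` ?D"] by metis
  define S where "S n = weighted V ` {D \<in> ?D. c n \<le> spectral_gap V D}" for n
  have decS: "decseq S"
    unfolding decseq_def S_def using c(1) by (auto simp: incseq_def intro!: image_mono intro: order_trans)
  have neS: "S n \<noteq> {}" for n
  proof -
    have "c n \<in> spectral_gap V ` ?D" using c(2) by blast
    then obtain D where "D \<in> ?D" "c n = spectral_gap V D" by blast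
    then have "weighted V D \<in> S n" unfolding S_def by (intro imageI) simp
    then show ?thesis by blast
  qed
  have measS: "f \<in> borel_measurable torus" if "f \<in> S n" for f n
    using that by (auto simp: S_def diffusions_iff[OF V N p b] intro: borel_measurable_weighted[OF V])
  have bddS: "AE q in torus. norm (f q) \<le> real CARD('n) * (real CARD('n) * (1 / b))" if "f \<in> S n" for f n
  proof -
    have "AE q in torus. f q \<in> bounded_matrices a b"
      using that by (auto simp: S_def diffusions_iff[OF V N p b])
    then show ?thesis by eventually_elim (rule bounded_matrices_norm_le[OF _ b])
  qed
  have midS: "(\<lambda>q. (1/2) *\<^sub>R (f q + g q)) \<in> S n" if fg: "f \<in> S n" "g \<in> S n" for f g n
  proof -
    obtain D E where D: "f = weighted V D" "D \<in> ?D" "c n \<le> spectral_gap V D"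
      and E: "g = weighted V E" "E \<in> ?D" "c n \<le> spectral_gap V E"
      using fg unfolding S_def by blast
    show ?thesis
      unfolding S_def D E weighted_midpoint[symmetric]
      using diffusions_midpoint[OF V N p b D(2) E(2)] spectral_gap_midpoint[OF V N p b D(2) E(2) D(3) E(3)] by blast
  qed
  obtain s where s: "\<And>n. s n \<in> S n" "AE q in torus. Cauchy (\<lambda>n. s n q)"
    by (rule nested_midpoint_convex_AE_Cauchy[OF torus.prob_space_axioms decS neS measS bddS midS]) blast+
  have "\<exists>D. s n = weighted V D \<and> D \<in> ?D \<and> c n \<le> spectral_gap V D" for n
    using s(1)[of n] unfolding S_def by blast
  then obtain D where D: "\<And>n. s n = weighted V (D n)" "\<And>n. D n \<in> ?D" "\<And>n. c n \<le> spectral_gap V (D n)" by metis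
  have "AE q in torus. Cauchy (\<lambda>n. weighted V (D n) q)" using s(2) unfolding D(1) .
  then obtain L where L: "L \<in> ?D" "\<And>n. c n \<le> spectral_gap V L"
    using diffusions_limit[OF V N p b D(2) _ c(1) D(3)] by metis
  have "spectral_gap V L = (SUP D\<in>?D. spectral_gap V D)"
  proof (rule antisym)
    show "spectral_gap V L \<le> (SUP D\<in>?D. spectral_gap V D)" using L(1) by (rule SUP_upper)
    show "(SUP D\<in>?D. spectral_gap V D) \<le> spectral_gap V L" using c(3) L(2) by (simp add: SUP_least)
  qed
  then show ?thesis using L(1) unfolding is_optimal_def by blast
qed

section \<open>Degenerate diffusions have nonpositive gap\<close>

text \<open>Moving the base point turns the derivative at 0 into the derivative anywhere on the
  line, as the mean value theorem requires.\<close>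

lemma has_derivative_along_axis:
  assumes "\<And>q. ((\<lambda>t. f (q + t *\<^sub>R axis i 1)) has_real_derivative g q) (at 0)"
  shows "((\<lambda>t. f (q + t *\<^sub>R axis i 1)) has_real_derivative g (q + s *\<^sub>R axis i 1)) (at s)"
proof -
  have "((\<lambda>t. f (q + (t + s) *\<^sub>R axis i 1)) has_real_derivative g (q + s *\<^sub>R axis i 1)) (at 0)"
    using assms[of "q + s *\<^sub>R axis i 1"] by (simp add: algebra_simps)
  then show ?thesis
    using DERIV_shift[of "\<lambda>t. f (q + t *\<^sub>R axis i 1)" "g (q + s *\<^sub>R axis i 1)" 0 s] by simp
qed

text \<open>The difference quotients have zero integral by translation invariance.\<close>

lemma torus_integral_derivative:
  fixes f g :: "real^'n \<Rightarrow> real"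
  assumes f: "Z_periodic f" "continuous_on UNIV f" and g: "Z_periodic g" "continuous_on UNIV g"
    and der: "\<And>q. ((\<lambda>t. f (q + t *\<^sub>R axis i 1)) has_real_derivative g q) (at 0)"
  shows "integral\<^sup>L torus g = 0"
proof -
  define h where "h n = 1 / real (Suc n)" for n
  have h: "0 < h n" "h n \<le> 1" for n by (auto simp: h_def)
  have h0: "h \<longlonglongrightarrow> 0" unfolding h_def by (rule LIMSEQ_Suc[OF lim_1_over_n])
  define d where "d n q = (f (q + h n *\<^sub>R axis i 1) - f q) / h n" for n q
  obtain B where B: "0 < B" "\<And>q. \<bar>g q\<bar> \<le> B" using continuous_periodic_bounded[OF g] by blast
  have shift: "Z_periodic (\<lambda>q. f (q + h n *\<^sub>R axis i 1))" "continuous_on UNIV (\<lambda>q. f (q + h n *\<^sub>R axis i 1))" for n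
  proof -
    have "f (q + axis j 1 + h n *\<^sub>R axis i 1) = f (q + h n *\<^sub>R axis i 1)" for q j
      using f(1) unfolding Z_periodic_def by (metis add.assoc add.commute)
    then show "Z_periodic (\<lambda>q. f (q + h n *\<^sub>R axis i 1))" by (simp add: Z_periodic_def)
    show "continuous_on UNIV (\<lambda>q. f (q + h n *\<^sub>R axis i 1))"
      by (intro continuous_on_compose2[OF f(2)] continuous_intros) auto
  qed
  have d0: "integral\<^sup>L torus (d n) = 0" for n
  proof -
    have "integral\<^sup>L torus (d n) = ((\<integral>q. f (q + h n *\<^sub>R axis i 1) \<partial>torus) - integral\<^sup>L torus f) / h n"
      unfolding d_def using integrable_torus_continuous[OF shift] integrable_torus_continuous[OF f] by simp
    then show ?thesis using torus_integral_translate[OF f, of "h n" i] h[of n] by simp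
  qed
  have "(\<lambda>n. integral\<^sup>L torus (d n)) \<longlonglongrightarrow> integral\<^sup>L torus g"
  proof (rule integral_dominated_convergence[where w="\<lambda>_. B"])
    show "g \<in> borel_measurable torus" by (rule borel_measurable_continuous_torus[OF g(2)])
    show "d n \<in> borel_measurable torus" for n
      unfolding d_def using borel_measurable_continuous_torus[OF shift(2)] borel_measurable_continuous_torus[OF f(2)]
      by measurable
    show "AE q in torus. (\<lambda>n. d n q) \<longlonglongrightarrow> g q"
    proof (rule AE_I2)
      fix q
      have "((\<lambda>t. (f (q + t *\<^sub>R axis i 1) - f q) / t) \<longlongrightarrow> g q) (at 0)"
        using der[of q] by (simp add: has_field_derivative_iff)
      moreover have "filterlim h (at 0) sequentially"
        using h0 h(1) by (auto simp: filterlim_at intro!: always_eventually less_imp_neq[symmetric])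
      ultimately show "(\<lambda>n. d n q) \<longlonglongrightarrow> g q"
        unfolding d_def by (rule filterlim_compose)
    qed
    \<comment> \<open>By the mean value theorem each difference quotient is a value of
      \<open>g\<close>, so the bound on \<open>g\<close> dominates the whole sequence.\<close>
    show "AE q in torus. norm (d n q) \<le> B" for n
    proof (rule AE_I2)
      fix q
      obtain z where "f (q + h n *\<^sub>R axis i 1) - f (q + 0 *\<^sub>R axis i 1) = (h n - 0) * g (q + z *\<^sub>R axis i 1)"
        using MVT2[OF h(1)[of n], of "\<lambda>t. f (q + t *\<^sub>R axis i 1)" "\<lambda>s. g (q + s *\<^sub>R axis i 1)"]
          has_derivative_along_axis[OF der] by blast
      then have "d n q = g (q + z *\<^sub>R axis i 1)" using h(1)[of n] by (simp add: d_def)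
      then show "norm (d n q) \<le> B" using B(2) by simp
    qed
  qed simp
  then show ?thesis using d0 by (simp add: LIMSEQ_const_iff)
qed

lemma smooth_torus_partial_deriv:
  assumes "\<phi> \<in> smooth_torus"
  shows "((\<lambda>t. \<phi> (q + t *\<^sub>R axis i 1)) has_real_derivative partial_deriv i \<phi> q) (at 0)"
    and "Z_periodic (partial_deriv i \<phi>)" and "continuous_on UNIV (partial_deriv i \<phi>)"
proof -
  have sm: "foldr partial_deriv is \<phi> differentiable_on UNIV" for "is"
    using assms unfolding smooth_torus_def smooth_def by blast
  have "\<phi> differentiable at (q + 0 *\<^sub>R axis i 1)"
    using sm[of "[]"] by (simp add: differentiable_on_def)
  moreover have "(\<lambda>t. q + t *\<^sub>R axis i 1) differentiable at (0::real)"
    by (intro derivative_intros)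
  ultimately have "(\<phi> \<circ> (\<lambda>t. q + t *\<^sub>R axis i 1)) differentiable at (0::real)"
    by (intro differentiable_chain_at)
  then have "(\<lambda>t. \<phi> (q + t *\<^sub>R axis i 1)) differentiable at (0::real)" by (simp add: o_def)
  then show "((\<lambda>t. \<phi> (q + t *\<^sub>R axis i 1)) has_real_derivative partial_deriv i \<phi> q) (at 0)"
    unfolding partial_deriv_def by (simp add: DERIV_deriv_iff_real_differentiable)
  have "\<phi> (q + axis j 1 + t *\<^sub>R axis i 1) = \<phi> (q + t *\<^sub>R axis i 1)" for q j t
    using smooth_torus_periodic[OF assms] unfolding Z_periodic_def by (metis add.assoc add.commute)
  then show "Z_periodic (partial_deriv i \<phi>)" by (simp add: Z_periodic_def partial_deriv_def)
  show "continuous_on UNIV (partial_deriv i \<phi>)"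
    using differentiable_imp_continuous_on[OF sm[of "[i]"]] by simp
qed

lemma L2_gibbs_continuous:
  fixes V :: "real^'n \<Rightarrow> real"
  assumes "V \<in> smooth_torus" "Z_periodic u" "continuous_on UNIV u" shows "u \<in> L2_gibbs V"
  unfolding L2_gibbs_iff[OF assms(1)]
proof (intro conjI borel_measurable_continuous_torus integrable_torus_continuous)
  show "Z_periodic (\<lambda>q. (u q)\<^sup>2)" using assms(2) by (simp add: Z_periodic_def)
  show "continuous_on UNIV (\<lambda>q. (u q)\<^sup>2)" using assms(3) by (intro continuous_intros)
qed (use assms in auto)

text \<open>Integration by parts: the derivative of \<open>u\<close> times a test function has zero
  integral over the torus. Continuity of the first derivatives is enough, which admits the C^1 bump
  used later.\<close>

lemma has_weak_gradient_classical:
  fixes V u :: "real^'n \<Rightarrow> real"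
  assumes V: "V \<in> smooth_torus" and u: "Z_periodic u" "continuous_on UNIV u"
    and g: "\<And>i. Z_periodic (g i)" "\<And>i. continuous_on UNIV (g i)"
    and der: "\<And>i q. ((\<lambda>t. u (q + t *\<^sub>R axis i 1)) has_real_derivative g i q) (at 0)"
  shows "has_weak_gradient V u (\<lambda>q. \<chi> i. g i q)"
  unfolding has_weak_gradient_def
proof (intro conjI allI ballI)
  show "(\<lambda>q. (\<chi> i. g i q) $ i) \<in> L2_gibbs V" for i using g L2_gibbs_continuous[OF V] by simp
  fix \<phi> :: "real^'n \<Rightarrow> real" and i assume \<phi>: "\<phi> \<in> smooth_torus"
  note \<phi>c = smooth_torus_continuous[OF \<phi>] and \<phi>p = smooth_torus_periodic[OF \<phi>]
    and d\<phi> = smooth_torus_partial_deriv[OF \<phi>]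
  have "integral\<^sup>L torus (\<lambda>q. u q * partial_deriv i \<phi> q + g i q * \<phi> q) = 0"
  proof (rule torus_integral_derivative[where f="\<lambda>q. u q * \<phi> q" and i=i])
    show "((\<lambda>t. u (q + t *\<^sub>R axis i 1) * \<phi> (q + t *\<^sub>R axis i 1)) has_real_derivative
        u q * partial_deriv i \<phi> q + g i q * \<phi> q) (at 0)" for q
      using DERIV_mult[OF der[of q i] d\<phi>(1)[of q i]] by (simp add: algebra_simps)
    show "Z_periodic (\<lambda>q. u q * \<phi> q)" "Z_periodic (\<lambda>q. u q * partial_deriv i \<phi> q + g i q * \<phi> q)"
      using u(1) \<phi>p d\<phi>(2)[of i] g(1)[of i] by (simp_all add: Z_periodic_def)
    show "continuous_on UNIV (\<lambda>q. u q * \<phi> q)" "continuous_on UNIV (\<lambda>q. u q * partial_deriv i \<phi> q + g i q * \<phi> q)"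
      by (intro continuous_intros u(2) \<phi>c d\<phi>(3) g(2))+
  qed
  moreover have "integrable torus (\<lambda>q. u q * partial_deriv i \<phi> q)"
    using u(1) d\<phi>(2)[of i]
    by (intro integrable_torus_continuous continuous_intros u(2) d\<phi>(3)) (simp add: Z_periodic_def)
  moreover have "integrable torus (\<lambda>q. g i q * \<phi> q)"
    using g(1)[of i] \<phi>p
    by (intro integrable_torus_continuous continuous_intros g(2) \<phi>c) (simp add: Z_periodic_def)
  ultimately show "(\<integral>q. u q * partial_deriv i \<phi> q \<partial>torus) = - (\<integral>q. (\<chi> i. g i q) $ i * \<phi> q \<partial>torus)"
    by simp
qed

text \<open>The zero set is closed. Having full measure in the open box it contains that box, hence
  its closure, and periodicity does the rest.\<close>

lemma continuous_periodic_AE_zero: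
  fixes u :: "real^'n \<Rightarrow> real"
  assumes u: "Z_periodic u" "continuous_on UNIV u" and AE: "AE q in torus. u q = 0"
  shows "u q = 0"
proof -
  let ?C = "{q. u q = 0}"
  have C: "closed ?C" by (intro closed_Collect_eq u(2) continuous_intros)
  have "AE q\<in>unit_cell in lebesgue. q \<in> ?C" using AE by (simp add: AE_restrict_space_iff)
  then have "AE q\<in>box 0 One in lebesgue. q \<in> ?C"
    by eventually_elim (use unit_cell_bounds(1) in auto)
  then have "q \<in> ?C" if "q \<in> box 0 One" for q
    using mem_closed_if_AE_lebesgue_open[OF open_box C] that by blast
  then have "closure (box 0 One) \<subseteq> ?C" using C by (intro closure_minimal) auto
  moreover have "closure (box 0 (One :: real^'n)) = cbox 0 One"
    by (rule closure_box) (auto simp: box_ne_empty)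
  ultimately have "unit_cell \<subseteq> ?C" using unit_cell_bounds(2) by blast
  moreover obtain q' where "q' \<in> unit_cell" "u q = u q'" by (rule Z_periodic_floor[OF u(1)])
  ultimately show ?thesis by auto
qed

text \<open>Squaring removes the kink of the positive part at 0 and makes the cut-off continuously
  differentiable.\<close>

lemma has_real_derivative_max_0_power2:
  "((\<lambda>x::real. (max 0 x)\<^sup>2) has_real_derivative 2 * max 0 x) (at x)"
proof (cases x "0::real" rule: linorder_cases)
  case less
  have "((\<lambda>x::real. 0) has_real_derivative 2 * max 0 x) (at x)" using less by simp
  then show ?thesis
    by (rule has_field_derivative_transform_within_open[where S="{..<0}"]) (use less in auto)
next
  case greater
  have "((\<lambda>x::real. x\<^sup>2) has_real_derivative 2 * max 0 x) (at x)"
    using greater by (auto intro!: derivative_eq_intros)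
  then show ?thesis
    by (rule has_field_derivative_transform_within_open[where S="{0<..}"]) (use greater in auto)
next
  case equal
  have "((\<lambda>y::real. ((max 0 y)\<^sup>2 - 0) / y) \<longlongrightarrow> 0) (at 0)"
  proof (rule Lim_null_comparison[where g="\<lambda>y. \<bar>y\<bar>"])
    show "\<forall>\<^sub>F y in at 0. norm (((max 0 y)\<^sup>2 - 0) / y) \<le> \<bar>y\<bar>"
      by (intro always_eventually) (auto simp: max_def power2_eq_square)
    show "((\<lambda>y::real. \<bar>y\<bar>) \<longlongrightarrow> 0) (at 0)" by (intro tendsto_eq_intros) auto
  qed
  then show ?thesis using equal by (simp add: has_field_derivative_iff)
qed

text \<open>A periodic $C^1$ bump at \<open>q0\<close> that needs no periodization: it is supported where every
  $\cos(2 \pi (q_i - q0_i))$ exceeds $1 - \delta$.\<close>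

definition bump_base :: "real \<Rightarrow> real^'n \<Rightarrow> real^'n \<Rightarrow> real" where
  "bump_base \<delta> q0 q = (\<Sum>i\<in>UNIV. cos (2 * pi * (q $ i - q0 $ i))) - (real CARD('n) - \<delta>)"

lemma bump_base_deriv:
  "((\<lambda>t. bump_base \<delta> q0 (q + t *\<^sub>R axis i 1)) has_real_derivative
     - (2 * pi * sin (2 * pi * (q $ i - q0 $ i)))) (at 0)"
proof -
  have "((\<lambda>t. cos (2 * pi * ((q + t *\<^sub>R axis i 1) $ j - q0 $ j))) has_real_derivative
      (if j = i then - (2 * pi * sin (2 * pi * (q $ i - q0 $ i))) else 0)) (at 0)" for j
    by (cases "j = i") (auto simp: axis_def intro!: derivative_eq_intros)
  then have "((\<lambda>t. bump_base \<delta> q0 (q + t *\<^sub>R axis i 1)) has_real_derivative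
     (\<Sum>j\<in>UNIV. if j = i then - (2 * pi * sin (2 * pi * (q $ i - q0 $ i))) else 0) - 0) (at 0)"
    unfolding bump_base_def by (intro DERIV_diff DERIV_sum DERIV_const)
  then show ?thesis by simp
qed

lemma bump_base_continuous: "continuous_on S (bump_base \<delta> q0)"
  unfolding bump_base_def by (intro continuous_intros)

lemma cos_2pi_diff_axis:
  "cos (2 * pi * ((q + axis i 1) $ j - q0 $ j)) = cos (2 * pi * (q $ j - q0 $ j))"
  "sin (2 * pi * ((q + axis i 1) $ j - q0 $ j)) = sin (2 * pi * (q $ j - q0 $ j))"
proof -
  have "2 * pi * ((q + axis i 1) $ j - q0 $ j) = 2 * pi * (q $ j - q0 $ j) + (if j = i then 2 * pi else 0)"
    by (simp add: axis_def algebra_simps)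
  then show "cos (2 * pi * ((q + axis i 1) $ j - q0 $ j)) = cos (2 * pi * (q $ j - q0 $ j))"
    "sin (2 * pi * ((q + axis i 1) $ j - q0 $ j)) = sin (2 * pi * (q $ j - q0 $ j))"
    by (simp_all only:) auto
qed

lemma bump_base_periodic: "Z_periodic (bump_base \<delta> q0)"
  by (simp only: Z_periodic_def bump_base_def cos_2pi_diff_axis) simp

text \<open>The other \<open>CARD('n) - 1\<close> cosines are at most 1 each, so positivity of the
  sum forces the remaining one above \<open>1 - \<delta>\<close>.\<close>

lemma bump_base_pos_imp:
  fixes q :: "real^'n"
  assumes "0 < bump_base \<delta> q0 q" shows "1 - \<delta> < cos (2 * pi * (q $ i - q0 $ i))"
proof -
  have "(\<Sum>j\<in>UNIV. cos (2 * pi * (q $ j - q0 $ j))) =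
      cos (2 * pi * (q $ i - q0 $ i)) + (\<Sum>j\<in>UNIV - {i}. cos (2 * pi * (q $ j - q0 $ j)))"
    by (rule sum.remove) auto
  also have "(\<Sum>j\<in>UNIV - {i}. cos (2 * pi * (q $ j - q0 $ j))) \<le> (\<Sum>j\<in>UNIV - {i}. 1)"
    by (intro sum_mono) simp
  also have "(\<Sum>j\<in>UNIV - {i}. 1) = real CARD('n) - 1" by (simp add: of_nat_diff)
  finally show ?thesis using assms by (simp add: bump_base_def)
qed

text \<open>The cosines see \<open>q\<close> only modulo integers. Rounding \<open>q - q0\<close>
  coordinatewise moves \<open>q\<close> to a representative \<open>q'\<close> with differences at
  most 1/2, where the cosine bound becomes a distance bound. So \<open>q'\<close> lies in a ball
  inside \<open>\<Omega>\<close>, and periodicity returns the conclusion to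
  \<open>q\<close>.\<close>

lemma bump_support:
  fixes \<Omega> :: "(real^'n) set"
  assumes \<Omega>: "open \<Omega>" "q0 \<in> \<Omega>" "Z_periodic (\<lambda>q. q \<in> \<Omega>)"
  obtains \<delta> where "0 < \<delta>" "\<delta> \<le> 2" "\<And>q. 0 < bump_base \<delta> q0 q \<Longrightarrow> q \<in> \<Omega>"
proof -
  obtain r where r: "0 < r" "ball q0 r \<subseteq> \<Omega>" using \<Omega>(1,2) open_contains_ball by blast
  \<comment> \<open>The first entry makes the sum of the coordinate distances less than
    \<open>r\<close>; the second keeps \<open>2 * pi * \<eta>\<close> within \<open>[0, pi]\<close>,
    where cosine decreases.\<close>
  define \<eta> where "\<eta> = min (r / real CARD('n)) (1/2)"
  have \<eta>: "0 < \<eta>" "\<eta> \<le> 1/2" "real CARD('n) * \<eta> \<le> r"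
    using r(1) by (auto simp: \<eta>_def min_def field_simps)
  define \<delta> where "\<delta> = 1 - cos (2 * pi * \<eta>)"
  have "cos (2 * pi * \<eta>) < cos 0" using \<eta> by (intro cos_monotone_0_pi) auto
  then have "0 < \<delta>" by (simp add: \<delta>_def)
  moreover have "\<delta> \<le> 2" using cos_ge_minus_one[of "2 * pi * \<eta>"] by (simp add: \<delta>_def)
  moreover have "q \<in> \<Omega>" if pos: "0 < bump_base \<delta> q0 q" for q
  proof -
    define m where "m i = round (q $ i - q0 $ i)" for i
    define q' where "q' = q + (\<chi> i. of_int (- m i))"
    have close: "\<bar>q' $ i - q0 $ i\<bar> < \<eta>" for i
    proof -
      define s where "s = q' $ i - q0 $ i"
      have s: "s = (q $ i - q0 $ i) - of_int (m i)" by (simp add: s_def q'_def)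
      have le: "\<bar>s\<bar> \<le> 1/2" using of_int_round_abs_le[of "q $ i - q0 $ i"] by (simp add: s m_def abs_minus_commute)
      have "2 * pi * (q $ i - q0 $ i) = 2 * pi * s + 2 * pi * of_int (m i)" by (simp add: s algebra_simps)
      then have "cos (2 * pi * (q $ i - q0 $ i)) = cos (2 * pi * s)" by (simp only: cos_add) simp
      moreover have "cos (2 * pi * s) = cos (2 * pi * \<bar>s\<bar>)" by (simp add: abs_if)
      ultimately have "cos (2 * pi * \<eta>) < cos (2 * pi * \<bar>s\<bar>)"
        using bump_base_pos_imp[OF pos, of i] by (simp add: \<delta>_def)
      then have "2 * pi * \<bar>s\<bar> < 2 * pi * \<eta>"
        using le \<eta> by (subst (asm) cos_mono_less_eq) auto
      then show ?thesis by (simp add: s_def)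
    qed
    have "norm (q' - q0) \<le> (\<Sum>i\<in>UNIV. \<bar>(q' - q0) $ i\<bar>)" by (rule norm_le_l1_cart)
    also have "\<dots> < (\<Sum>i\<in>(UNIV::'n set). \<eta>)" by (intro sum_strict_mono) (use close in auto)
    finally have "norm (q' - q0) < r" using \<eta>(3) by simp
    then have "q' \<in> \<Omega>" using r(2) by (auto simp: dist_norm norm_minus_commute)
    then show ?thesis using Z_periodic_add_ints[OF \<Omega>(3), of q "\<lambda>i. - m i"] by (simp add: q'_def)
  qed
  ultimately show ?thesis using that by blast
qed

text \<open>The test function is the squared positive part of the bump minus its Gibbs mean. The
  constant does not affect the gradient, which vanishes outside \<open>\<Omega>\<close>, while
  \<open>D\<close> vanishes a.e. inside, so the energy is 0.\<close>

lemma spectral_gap_nonpos: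
  fixes V :: "real^'n \<Rightarrow> real" and D :: "real^'n \<Rightarrow> real^'n^'n"
  assumes V: "V \<in> smooth_torus" and \<Omega>: "open \<Omega>" "\<Omega> \<noteq> {}" "Z_periodic (\<lambda>q. q \<in> \<Omega>)"
    and D: "AE q in torus. q \<in> \<Omega> \<longrightarrow> D q = 0"
  shows "spectral_gap V D \<le> 0"
proof -
  obtain q0 where q0: "q0 \<in> \<Omega>" using \<Omega>(2) by blast
  obtain \<delta> where \<delta>: "0 < \<delta>" "\<delta> \<le> 2" "\<And>q. 0 < bump_base \<delta> q0 q \<Longrightarrow> q \<in> \<Omega>"
    using bump_support[OF \<Omega>(1) q0 \<Omega>(3)] by blast
  define w where "w q = (max 0 (bump_base \<delta> q0 q))\<^sup>2" for q
  define m where "m = (\<integral>q. w q * gibbs V q \<partial>torus)"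
  define u where "u q = w q - m" for q
  define g where "g i q = 2 * max 0 (bump_base \<delta> q0 q) * - (2 * pi * sin (2 * pi * (q $ i - q0 $ i)))" for i q
  define G where "G q = (\<chi> i. g i q)" for q
  have wp: "Z_periodic w" using bump_base_periodic[of \<delta> q0] by (simp add: Z_periodic_def w_def)
  have wc: "continuous_on UNIV w" unfolding w_def by (intro continuous_intros bump_base_continuous)
  have up: "Z_periodic u" using wp by (simp add: Z_periodic_def u_def)
  have uc: "continuous_on UNIV u" unfolding u_def by (intro continuous_intros wc)
  have G: "has_weak_gradient V u G"
    unfolding G_def[abs_def]
  proof (rule has_weak_gradient_classical[OF V up uc])
    show "Z_periodic (g i)" for i
      using bump_base_periodic[of \<delta> q0] by (simp only: Z_periodic_def g_def cos_2pi_diff_axis) simp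
    show "continuous_on UNIV (g i)" for i
      unfolding g_def by (intro continuous_intros bump_base_continuous)
    show "((\<lambda>t. u (q + t *\<^sub>R axis i 1)) has_real_derivative g i q) (at 0)" for i q
    proof -
      have "((\<lambda>x. (max 0 x)\<^sup>2) has_real_derivative 2 * max 0 (bump_base \<delta> q0 q)) (at (bump_base \<delta> q0 (q + 0 *\<^sub>R axis i 1)))"
        using has_real_derivative_max_0_power2[of "bump_base \<delta> q0 q"] by simp
      from DERIV_diff[OF DERIV_chain2[OF this bump_base_deriv[of \<delta> q0 q i]] DERIV_const[of m]]
      show ?thesis by (simp add: u_def w_def g_def)
    qed
  qed
  have L2: "u \<in> L2_gibbs V" by (rule L2_gibbs_continuous[OF V up uc])
  have "integrable torus (\<lambda>q. w q * gibbs V q)"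
  proof (rule integrable_torus_continuous)
    have "continuous_on UNIV (gibbs V)" unfolding gibbs_def
      using partition_const_pos[OF V] by (intro continuous_intros smooth_torus_continuous V) auto
    then show "continuous_on UNIV (\<lambda>q. w q * gibbs V q)" by (intro continuous_intros wc)
    show "Z_periodic (\<lambda>q. w q * gibbs V q)"
      using wp smooth_torus_periodic[OF V] by (simp add: Z_periodic_def gibbs_def)
  qed
  then have "(\<integral>q. u q * gibbs V q \<partial>torus) = 0"
    using integral_gibbs[OF V] by (simp add: u_def left_diff_distrib m_def[symmetric])
  then have H1: "u \<in> H1_zero_mean V" using L2 G by (auto simp: H1_zero_mean_def H1_def)
  have nz: "\<not> (AE q in torus. u q = 0)"
  proof
    assume "AE q in torus. u q = 0"
    then have *: "u q = 0" for q using continuous_periodic_AE_zero[OF up uc] by blast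
    define j :: 'n where "j = undefined"
    have "bump_base \<delta> q0 q0 = \<delta>" by (simp add: bump_base_def)
    then have "w q0 = \<delta>\<^sup>2" using \<delta>(1) by (simp add: w_def)
    \<comment> \<open>Half a period away from \<open>q0\<close> one cosine equals -1, which does not
      exceed \<open>1 - \<delta>\<close> because \<open>\<delta> \<le> 2\<close>. So
      \<open>w\<close> takes two different values and no constant makes it vanish
      identically.\<close>
    moreover have "w (q0 + (1/2) *\<^sub>R axis j 1) = 0"
    proof -
      have "\<not> 0 < bump_base \<delta> q0 (q0 + (1/2) *\<^sub>R axis j 1)"
        using bump_base_pos_imp[of \<delta> q0 "q0 + (1/2) *\<^sub>R axis j 1" j] \<delta>(2) by (auto simp: axis_def)
      then show ?thesis by (simp add: w_def max_def)
    qed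
    ultimately show False using *[of q0] *[of "q0 + (1/2) *\<^sub>R axis j 1"] \<delta>(1) by (simp add: u_def)
  qed
  have "integral\<^sup>L torus (energy V D G) = 0"
  proof (rule integral_eq_zero_AE)
    show "AE q in torus. energy V D G q = 0"
      using D
    proof eventually_elim
      case (elim q)
      have "G q = 0" if "q \<notin> \<Omega>"
      proof -
        have "\<not> 0 < bump_base \<delta> q0 q" using \<delta>(3) that by blast
        then show ?thesis by (simp add: G_def g_def vec_eq_iff max_def)
      qed
      then show ?case using elim by (cases "q \<in> \<Omega>") (auto simp: energy_def)
    qed
  qed
  moreover have "spectral_gap V D \<le> ereal (integral\<^sup>L torus (energy V D G) / (\<integral>q. (u q)\<^sup>2 * gibbs V q \<partial>torus))"
    \<comment> \<open>With \<open>c\<close> equal to the gap itself, the equivalence says that the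
      gap is at most each Rayleigh quotient.\<close>
    using le_spectral_gap_iff[of "spectral_gap V D" V D] H1 nz G by blast
  ultimately show ?thesis by (simp add: zero_ereal_def)
qed

section \<open>Isotropic diffusions and the conclusion\<close>

text \<open>The exponential cancels the weight in the constraints, which thereby become conditions
  on the number \<open>c\<close>.\<close>

definition isotropic :: "(real^'n \<Rightarrow> real) \<Rightarrow> real \<Rightarrow> real^'n \<Rightarrow> real^'n^'n" where
  "isotropic V c q = (exp (V q) * c) *\<^sub>R mat 1"

lemma weighted_isotropic: "weighted V (isotropic V c) q = c *\<^sub>R mat 1"
  by (simp add: weighted_def isotropic_def flip: exp_add mult.assoc)

lemma psd_scaleR_mat_1: "0 \<le> c \<Longrightarrow> psd (c *\<^sub>R mat 1 :: real^'n^'n)"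
proof -
  have "transpose (c *\<^sub>R mat 1 :: real^'n^'n) = c *\<^sub>R mat 1"
    by (simp add: transpose_def mat_def vec_eq_iff)
  then show "psd (c *\<^sub>R mat 1 :: real^'n^'n)" if "0 \<le> c"
    using that by (simp add: psd_def scaleR_matrix_vector_assoc[symmetric])
qed

lemma isotropic_diffusion:
  fixes V :: "real^'n \<Rightarrow> real" and N :: "real^'n^'n \<Rightarrow> real"
  assumes V: "V \<in> smooth_torus" and N: "matrix_norm N" and p: "1 \<le> p" and b: "0 < b"
    and c: "0 \<le> c" "a \<le> c" "c \<le> 1 / b" "c * N (mat 1) \<le> 1"
  shows "isotropic V c \<in> diffusions N V p a b"
  unfolding diffusions_iff[OF V N p b] weighted_isotropic
proof (intro conjI allI)
  show "Z_periodic (isotropic V c)"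
    using smooth_torus_periodic[OF V] by (simp add: Z_periodic_def isotropic_def)
  show "isotropic V c \<in> borel_measurable torus"
    unfolding isotropic_def
    by (intro borel_measurable_continuous_torus continuous_intros smooth_torus_continuous V)
  show "psd (isotropic V c q)" for q unfolding isotropic_def using c(1) by (intro psd_scaleR_mat_1) simp
  have "a * (norm \<xi>)\<^sup>2 \<le> c * (norm \<xi>)\<^sup>2" "c * (norm \<xi>)\<^sup>2 \<le> 1 / b * (norm \<xi>)\<^sup>2" for \<xi> :: "real^'n"
    using c(2,3) by (intro mult_right_mono; simp)+
  then have "c *\<^sub>R mat 1 \<in> (bounded_matrices a b :: (real^'n^'n) set)"
    unfolding bounded_matrices_def using psd_scaleR_mat_1[OF c(1)]
    by (simp add: scaleR_matrix_vector_assoc[symmetric] power2_norm_eq_inner)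
  then show "AE q in torus. c *\<^sub>R mat 1 \<in> (bounded_matrices a b :: (real^'n^'n) set)" by simp
  have "N (c *\<^sub>R mat 1) = \<bar>c\<bar> * N (mat 1)" using N unfolding matrix_norm_def by blast
  then have "N (c *\<^sub>R mat 1) \<le> 1" using c by simp
  moreover have "0 \<le> N (c *\<^sub>R mat 1)" using N unfolding matrix_norm_def by blast
  ultimately have "N (c *\<^sub>R mat 1) powr p \<le> 1" using p by (intro powr_le1) auto
  then show "(\<integral>q. N (c *\<^sub>R mat 1) powr p \<partial>(torus :: (real^'n) measure)) \<le> 1"
    using torus.prob_space[where 'n='n] by simp
qed

text \<open>The energy is a multiple of the flat Dirichlet integral, to which the Poincare
  inequality applies. What remains is to compare the Gibbs norm of \<open>u\<close> with its
  Lebesgue variance.\<close>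

lemma spectral_gap_isotropic_pos:
  fixes V :: "real^'n \<Rightarrow> real"
  assumes V: "V \<in> smooth_torus" and c: "0 < c"
  shows "0 < spectral_gap V (isotropic V c)"
proof -
  obtain m M where m: "0 < m" "\<And>q. m \<le> gibbs V q" and M: "\<And>q. gibbs V q \<le> M"
    using gibbs_bounds[OF V] by blast
  have "0 < M" using m(1) m(2)[of 0] M[of 0] by linarith
  have Z: "0 < partition_const V" by (rule partition_const_pos[OF V])
  \<comment> \<open>The factor of the Dirichlet integral, the Poincare constant, and the loss from
    bounding the density by \<open>M\<close>.\<close>
  define \<kappa> where "\<kappa> = c / partition_const V * (4 * pi\<^sup>2) / M"
  have \<kappa>: "0 < \<kappa>" using c Z \<open>0 < M\<close> by (simp add: \<kappa>_def)
  have "ereal \<kappa> \<le> spectral_gap V (isotropic V c)"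
    unfolding le_spectral_gap_iff
  proof (intro allI impI, elim conjE)
    fix u G assume u: "u \<in> H1_zero_mean V" "\<not> (AE q in torus. u q = 0)" and G: "has_weak_gradient V u G"
    have L2: "u \<in> L2_gibbs V" and mean: "(\<integral>q. u q * gibbs V q \<partial>torus) = 0"
      using u(1) by (auto simp: H1_zero_mean_def H1_def)
    have um: "u \<in> borel_measurable torus" and u2: "integrable torus (\<lambda>q. (u q)\<^sup>2)"
      using L2 by (auto simp: L2_gibbs_iff[OF V])
    have iu2: "integrable torus (\<lambda>q. (u q)\<^sup>2 * gibbs V q)" using L2 by (simp add: L2_gibbs_def)
    have iu: "integrable torus (\<lambda>q. u q * gibbs V q)"
    proof (rule Bochner_Integration.integrable_bound[where f="\<lambda>q. M * u q"])
      show "integrable torus (\<lambda>q. M * u q)"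
        using torus_square_integrable_imp_integrable[OF um u2] by simp
      show "AE q in torus. norm (u q * gibbs V q) \<le> norm (M * u q)"
      proof (rule AE_I2)
        fix q
        have "\<bar>gibbs V q\<bar> \<le> \<bar>M\<bar>" using M[of q] m(1) m(2)[of q] by linarith
        then have "\<bar>gibbs V q\<bar> * \<bar>u q\<bar> \<le> \<bar>M\<bar> * \<bar>u q\<bar>" by (intro mult_right_mono) auto
        then show "norm (u q * gibbs V q) \<le> norm (M * u q)" by (simp add: abs_mult mult.commute)
      qed
    qed (use um borel_measurable_gibbs[OF V] in measurable)
    define k where "k = integral\<^sup>L torus u"
    have iv: "integrable torus (\<lambda>q. (u q - k)\<^sup>2)"
      using integrable_power2_diff[OF um _ u2, of "\<lambda>_. k"] by simp
    define U where "U = (\<integral>q. (u q)\<^sup>2 * gibbs V q \<partial>torus)"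
    have exp: "(u q - k)\<^sup>2 * gibbs V q = (u q)\<^sup>2 * gibbs V q - 2 * k * (u q * gibbs V q) + k\<^sup>2 * gibbs V q" for q
      by (simp add: power2_eq_square algebra_simps)
    have ivg: "integrable torus (\<lambda>q. (u q - k)\<^sup>2 * gibbs V q)"
      unfolding exp using iu2 iu integral_gibbs(1)[OF V] by simp
    \<comment> \<open>The cross term vanishes because \<open>u\<close> has zero Gibbs mean.
      Subtracting the Lebesgue mean \<open>k\<close> can thus only increase the weighted
      norm.\<close>
    have "(\<integral>q. (u q - k)\<^sup>2 * gibbs V q \<partial>torus) = U + k\<^sup>2"
      unfolding exp U_def using iu2 iu integral_gibbs[OF V] mean by simp
    then have "U \<le> (\<integral>q. (u q - k)\<^sup>2 * gibbs V q \<partial>torus)" by simp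
    also have "\<dots> \<le> (\<integral>q. M * (u q - k)\<^sup>2 \<partial>torus)"
      using ivg iv M by (intro integral_mono) (auto simp: mult.commute intro: mult_right_mono)
    finally have UM: "U / M \<le> (\<integral>q. (u q - k)\<^sup>2 \<partial>torus)" using \<open>0 < M\<close> by (simp add: field_simps)
    have "energy V (isotropic V c) G = (\<lambda>q. c / partition_const V * (norm (G q))\<^sup>2)"
      unfolding fun_eq_iff energy_weighted weighted_isotropic
      by (simp add: scaleR_matrix_vector_assoc[symmetric] power2_norm_eq_inner)
    then have E: "integral\<^sup>L torus (energy V (isotropic V c) G) = c / partition_const V * (\<integral>q. (norm (G q))\<^sup>2 \<partial>torus)"
      by simp
    have "\<kappa> * U = c / partition_const V * (4 * pi\<^sup>2) * (U / M)" by (simp add: \<kappa>_def)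
    also have "\<dots> \<le> c / partition_const V * (4 * pi\<^sup>2) * (\<integral>q. (u q - k)\<^sup>2 \<partial>torus)"
      using UM c Z by (intro mult_left_mono) auto
    also have "\<dots> \<le> c / partition_const V * (\<integral>q. (norm (G q))\<^sup>2 \<partial>torus)"
      using poincare_inequality[OF V L2 G] c Z unfolding k_def[symmetric] mult.assoc
      by (intro mult_left_mono) auto
    finally have le: "\<kappa> * U \<le> integral\<^sup>L torus (energy V (isotropic V c) G)" by (simp only: E)
    have g0: "0 < gibbs V q" for q using m(1) m(2)[of q] by linarith
    \<comment> \<open>Division by zero would yield 0 and defeat the lower bound; the positive
      density turns \<open>U = 0\<close> into \<open>u = 0\<close> a.e.\<close>
    have "U \<noteq> 0"
    proof
      assume "U = 0"
      then have "AE q in torus. (u q)\<^sup>2 * gibbs V q = 0"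
        using iu2 g0 unfolding U_def by (subst (asm) integral_nonneg_eq_0_iff_AE) (auto simp: less_imp_le)
      then have "AE q in torus. u q = 0"
        by eventually_elim (metis g0 less_irrefl mult_eq_0_iff power_eq_0_iff)
      then show False using u(2) by simp
    qed
    moreover have "0 \<le> U" unfolding U_def using g0 by (intro integral_nonneg_AE) (auto simp: less_imp_le)
    ultimately have "\<kappa> \<le> integral\<^sup>L torus (energy V (isotropic V c) G) / U"
      using le by (simp add: pos_le_divide_eq)
    then show "ereal \<kappa> \<le> ereal (integral\<^sup>L torus (energy V (isotropic V c) G) / (\<integral>q. (u q)\<^sup>2 * gibbs V q \<partial>torus))"
      by (simp add: U_def)
  qed
  then show ?thesis using \<kappa> by (metis ereal_less(2) order.strict_trans2)
qed

theorem theorem4: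
  fixes V :: "real^'n \<Rightarrow> real" and N :: "real^'n^'n \<Rightarrow> real" and p a b :: real
  assumes "V \<in> smooth_torus"
    and "matrix_norm N" and "loewner_monotone N"
    and "1 \<le> p"
    and "0 \<le> a" and "a \<le> a_max N"
    and "0 < b" and "a * b \<le> 1"
  shows "(\<exists>D. is_optimal N V p a b D) \<and>
         (\<forall>D. is_optimal N V p a b D \<longrightarrow>
            (\<forall>\<Omega>. open \<Omega> \<and> \<Omega> \<noteq> {} \<and> Z_periodic (\<lambda>q. q \<in> \<Omega>) \<longrightarrow>
                 \<not> (AE q in torus. q \<in> \<Omega> \<longrightarrow> D q = 0)))"
proof -
  \<comment> \<open>The largest multiple of the identity allowed by both upper bounds. The
    assumptions \<open>a * b \<le> 1\<close> and \<open>a \<le> a_max N\<close> give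
    \<open>a \<le> c\<close>, and \<open>c\<close> is positive even for
    \<open>a = 0\<close>.\<close>
  define c where "c = min (1 / b) (a_max N)"
  have "N (mat 1) \<noteq> 0"
  proof -
    have "(mat 1 :: real^'n^'n) $ i $ i = 1" for i by (simp add: mat_def)
    then have "(mat 1 :: real^'n^'n) \<noteq> 0" by (metis zero_index zero_neq_one)
    then show ?thesis using assms(2) by (simp add: matrix_norm_def)
  qed
  moreover have "0 \<le> N (mat 1)" using assms(2) by (simp add: matrix_norm_def)
  ultimately have N1: "0 < N (mat 1)" by simp
  then have c: "0 < c" using assms(7) by (simp add: c_def a_max_def)
  have "a \<le> 1 / b" using assms(7,8) by (simp add: pos_le_divide_eq)
  then have ac: "a \<le> c" "c \<le> 1 / b" using assms(6) by (auto simp: c_def)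
  have "c * N (mat 1) \<le> a_max N * N (mat 1)" using N1 by (intro mult_right_mono) (auto simp: c_def)
  then have "c * N (mat 1) \<le> 1" using N1 by (simp add: a_max_def)
  then have iso: "isotropic V c \<in> diffusions N V p a b"
    using c ac by (intro isotropic_diffusion assms) auto
  show ?thesis
  proof (intro conjI allI impI notI, goal_cases)
    case 1
    show ?case using iso by (intro optimal_diffusion_exists assms) auto
  next
    case (2 D \<Omega>)
    have "0 < spectral_gap V (isotropic V c)" by (rule spectral_gap_isotropic_pos[OF assms(1) c])
    also have "\<dots> \<le> (SUP D\<in>diffusions N V p a b. spectral_gap V D)" using iso by (rule SUP_upper)
    also have "\<dots> = spectral_gap V D" using 2(1) by (simp add: is_optimal_def)
    also have "\<dots> \<le> 0" using 2(2,3) by (intro spectral_gap_nonpos[OF assms(1)]) auto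
    finally show False by simp
  qed
qed

end
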